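(* Let $\mathbb{K}$ be a field with $\mathrm{char}(\mathbb{K})=0$ and let $\delta\in\mathbb{Z}$. Then: (a) for $r,s\in\mathbb{Z}_{\geq 0}$ not both zero, the walled Brauer algebra $\mathcal{B}_{r,s}(\delta)$ over $\mathbb{K}$ is semisimple if and only if the walled Brauer algebra $\mathcal{B}_{r,s}(\delta)$ over $\mathbb{F}_p$ (with $\delta$ replaced by its image in $\mathbb{F}_p$) is semisimple for infinitely many primes $p$; (b) for $d\in\mathbb{Z}_{>0}$, the Brauer algebra $\mathcal{B}_d(\delta)$ over $\mathbb{K}$ is semisimple if and only if the Brauer algebra $\mathcal{B}_d(\delta)$ over $\mathbb{F}_p$ is semisimple for infinitely many primes $p$.
   Context: For a commutative ring $R$ and $\delta\in R$: the walled Brauer algebra $\mathcal{B}_{r,s}(\delta)$ over $R$ is the free $R$-module with basis the walled Brauer diagrams (Brauer diagrams on $r+s$ top and $r+s$ bottom points with a wall separating the first $r$ from the last $s$ points, such that vertical strands connect points on the same side of the wall and horizontal arcs connect points on opposite sides), with multiplication given by concatenation where each closed loop is replaced by the factor $\delta$; over a field it is equivalently generated by $\sigma_i$ ($i\neq r$) and $u_r$ with the standard walled Brauer relations ($\sigma_i^2=1$, braid relations, $u_r^2=\delta u_r$, $u_r=u_r\sigma_{r\pm1}u_r$, $u_r\sigma_j=\sigma_ju_r$ for $|r-j|>1$, $u_r\sigma_{r-1}\sigma_{r+1}u_r\sigma_{r-1}\sigma_{r+1}=u_r\sigma_{r-1}\sigma_{r+1}u_r=\sigma_{r-1}\sigma_{r+1}u_r\sigma_{r-1}\sigma_{r+1}u_r$).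 The Brauer algebra $\mathcal{B}_d(\delta)$ over $R$ is the free $R$-module with basis all Brauer diagrams (perfect matchings of $d$ top and $d$ bottom points), multiplied by concatenation with closed loops replaced by $\delta$. Both algebras over a field are obtained from the integral versions over $\mathbb{Z}$ by scalar extension. *)

theory Defs
  imports "HOL-Algebra.Algebra" "HOL-Number_Theory.Residues"
begin

text \<open>Points of a diagram on d top and d bottom points: (True, i) is the i-th top point,
 (False, i) the i-th bottom point, for i < d. A Brauer diagram (perfect matching)
 is a fixed-point-free involution of the point set, extended by the identity elsewhere.\<close>

type_synonym diagram = "bool \<times> nat \<Rightarrow> bool \<times> nat"

definition pts :: "nat \<Rightarrow> (bool \<times> nat) set" where
  "pts d = UNIV \<times> {..<d}"

definition brauer_diagrams :: "nat \<Rightarrow> diagram set" where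
  "brauer_diagrams d = {m. (\<forall>p\<in>pts d. m p \<in> pts d \<and> m p \<noteq> p \<and> m (m p) = p)
                          \<and> (\<forall>p. p \<notin> pts d \<longrightarrow> m p = p)}"

text \<open>Walled Brauer diagrams on r+s points: points with index < r lie left of the wall.
 Vertical strands (top to bottom) stay on one side; horizontal arcs cross the wall.\<close>

definition walled_brauer_diagrams :: "nat \<Rightarrow> nat \<Rightarrow> diagram set" where
  "walled_brauer_diagrams r s = {m \<in> brauer_diagrams (r + s).
     \<forall>p\<in>pts (r + s).
       (if fst (m p) = fst p then (snd (m p) < r) \<noteq> (snd p < r)
        else (snd (m p) < r) = (snd p < r))}"

definition id_diagram :: "nat \<Rightarrow> diagram" where
  "id_diagram d = (\<lambda>(t, i). if i < d then (\<not> t, i) else (t, i))"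

text \<open>Stacking a on top of b: level 0 = top row of a, level 1 = middle row
 (bottom of a identified with top of b), level 2 = bottom row of b.\<close>

definition lvl_a :: "bool \<times> nat \<Rightarrow> nat \<times> nat" where
  "lvl_a p = (if fst p then 0 else 1, snd p)"

definition lvl_b :: "bool \<times> nat \<Rightarrow> nat \<times> nat" where
  "lvl_b p = (if fst p then 1 else 2, snd p)"

definition lvl_out :: "bool \<times> nat \<Rightarrow> nat \<times> nat" where
  "lvl_out p = (if fst p then 0 else 2, snd p)"

definition unlvl :: "nat \<times> nat \<Rightarrow> bool \<times> nat" where
  "unlvl v = (fst v = 0, snd v)"

definition stack_edges :: "nat \<Rightarrow> diagram \<Rightarrow> diagram \<Rightarrow> ((nat \<times> nat) \<times> (nat \<times> nat)) set" where
  "stack_edges d a b = {(lvl_a p, lvl_a (a p)) | p. p \<in> pts d}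
                     \<union> {(lvl_b p, lvl_b (b p)) | p. p \<in> pts d}"

definition stack_conn :: "nat \<Rightarrow> diagram \<Rightarrow> diagram \<Rightarrow> ((nat \<times> nat) \<times> (nat \<times> nat)) set" where
  "stack_conn d a b = ((stack_edges d a b) \<union> (stack_edges d a b)\<inverse>)\<^sup>*"

definition outer :: "nat \<Rightarrow> nat \<times> nat \<Rightarrow> bool" where
  "outer d v \<longleftrightarrow> fst v \<noteq> 1 \<and> fst v \<le> 2 \<and> snd v < d"

definition compose :: "nat \<Rightarrow> diagram \<Rightarrow> diagram \<Rightarrow> diagram" where
  "compose d a b = (\<lambda>p. if p \<in> pts d then
       unlvl (THE w. w \<noteq> lvl_out p \<and> outer d w \<and> (lvl_out p, w) \<in> stack_conn d a b)
     else p)"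

definition loops :: "nat \<Rightarrow> diagram \<Rightarrow> diagram \<Rightarrow> nat" where
  "loops d a b = card {stack_conn d a b `` {v} | v.
       fst v = 1 \<and> snd v < d \<and> (\<forall>w \<in> stack_conn d a b `` {v}. \<not> outer d w)}"

definition diagram_alg :: "('a, 'm) ring_scheme \<Rightarrow> int \<Rightarrow> nat \<Rightarrow> diagram set
    \<Rightarrow> (diagram \<Rightarrow> 'a) ring" where
  "diagram_alg R \<delta> d D =
    \<lparr> carrier = {f. (\<forall>x\<in>D. f x \<in> carrier R) \<and> (\<forall>x. x \<notin> D \<longrightarrow> f x = \<zero>\<^bsub>R\<^esub>)},
      monoid.mult = (\<lambda>f g c. if c \<in> D then
          finsum R (\<lambda>(a, b). (f a \<otimes>\<^bsub>R\<^esub> g b) \<otimes>\<^bsub>R\<^esub>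
                     ((add_pow R \<delta> \<one>\<^bsub>R\<^esub>) [^]\<^bsub>R\<^esub> (loops d a b)))
                   {(a, b). a \<in> D \<and> b \<in> D \<and> compose d a b = c}
        else \<zero>\<^bsub>R\<^esub>),
      one = (\<lambda>c. if c = id_diagram d then \<one>\<^bsub>R\<^esub> else \<zero>\<^bsub>R\<^esub>),
      ring.zero = (\<lambda>c. \<zero>\<^bsub>R\<^esub>),
      ring.add = (\<lambda>f g c. if c \<in> D then f c \<oplus>\<^bsub>R\<^esub> g c else \<zero>\<^bsub>R\<^esub>) \<rparr>"

definition brauer_alg :: "('a, 'm) ring_scheme \<Rightarrow> int \<Rightarrow> nat \<Rightarrow> (diagram \<Rightarrow> 'a) ring" where
  "brauer_alg R \<delta> d = diagram_alg R \<delta> d (brauer_diagrams d)"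

definition walled_brauer_alg :: "('a, 'm) ring_scheme \<Rightarrow> int \<Rightarrow> nat \<Rightarrow> nat \<Rightarrow> (diagram \<Rightarrow> 'a) ring" where
  "walled_brauer_alg R \<delta> r s = diagram_alg R \<delta> (r + s) (walled_brauer_diagrams r s)"

definition left_ideal :: "'a set \<Rightarrow> ('a, 'm) ring_scheme \<Rightarrow> bool" where
  "left_ideal I A \<longleftrightarrow> I \<subseteq> carrier A \<and> \<zero>\<^bsub>A\<^esub> \<in> I
     \<and> (\<forall>x\<in>I. \<forall>y\<in>I. x \<oplus>\<^bsub>A\<^esub> y \<in> I)
     \<and> (\<forall>x\<in>I. \<ominus>\<^bsub>A\<^esub> x \<in> I)
     \<and> (\<forall>a\<in>carrier A. \<forall>x\<in>I. a \<otimes>\<^bsub>A\<^esub> x \<in> I)"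

definition semisimple :: "('a, 'm) ring_scheme \<Rightarrow> bool" where
  "semisimple A \<longleftrightarrow> (\<forall>I. left_ideal I A \<longrightarrow>
     (\<exists>J. left_ideal J A \<and> I \<inter> J = {\<zero>\<^bsub>A\<^esub>}
          \<and> (\<forall>x\<in>carrier A. \<exists>i\<in>I. \<exists>j\<in>J. x = i \<oplus>\<^bsub>A\<^esub> j)))"

end

theory Submission
  imports Defs "HOL-Combinatorics.Cycles" "HOL-Library.Disjoint_Sets" "Jordan_Normal_Form.Determinant"
begin

text \<open>
  The diagrams form a basis with integral structure constants, so the trace form
  \<open>(a, b) \<mapsto> tr (left multiplication by ab)\<close> has an integral Gram matrix \<open>G\<close>, independent of the field.
  If \<open>det G\<close> is nonzero in the field, dual bases for the trace form give a Casimir element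
  \<open>\<Sum> a\<^sub>i \<otimes> b\<^sub>i\<close> with \<open>\<Sum> a\<^sub>i b\<^sub>i = 1\<close>, and averaging a linear projection onto a left ideal with it
  yields a right unit of that ideal; hence the algebra is semisimple.
  If \<open>det G\<close> vanishes in the field, the radical of the trace form is a nonzero left ideal; were the
  algebra semisimple, this ideal would have an idempotent right unit \<open>e \<noteq> 0\<close>, and the trace of
  left multiplication by \<open>e\<close>, namely its rank, would be zero in the field. This is impossible if the
  characteristic is zero or exceeds the dimension.
  So both sides of the equivalence amount to \<open>det G \<noteq> 0\<close> over the integers.

  Associativity of the diagram calculus is read off from the action of diagrams on tensor powers of a
  two-dimensional space, which is multiplicative up to the factor \<open>2\<close> per closed loop and faithful.
\<close>

section \<open>Orbits of two involutions\<close>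

definition dihedral_conn :: "('v \<Rightarrow> 'v) \<Rightarrow> ('v \<Rightarrow> 'v) \<Rightarrow> ('v \<times> 'v) set" where
  "dihedral_conn \<alpha> \<beta> = {(v, w). w = \<alpha> v \<or> w = \<beta> v}\<^sup>*"

lemma dihedral_conn_commute: "dihedral_conn \<alpha> \<beta> = dihedral_conn \<beta> \<alpha>"
  by (simp add: dihedral_conn_def disj_commute)

lemma dihedral_conn_refl [simp]: "(x, x) \<in> dihedral_conn \<alpha> \<beta>"
  by (simp add: dihedral_conn_def)

lemma dihedral_conn_trans:
  "(x, y) \<in> dihedral_conn \<alpha> \<beta> \<Longrightarrow> (y, z) \<in> dihedral_conn \<alpha> \<beta> \<Longrightarrow> (x, z) \<in> dihedral_conn \<alpha> \<beta>"
  unfolding dihedral_conn_def by (rule rtrancl_trans)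

lemma dihedral_conn_step:
  "(x, \<alpha> x) \<in> dihedral_conn \<alpha> \<beta>" "(x, \<beta> x) \<in> dihedral_conn \<alpha> \<beta>"
  unfolding dihedral_conn_def by (auto intro: r_into_rtrancl)

lemma dihedral_conn_induct [consumes 1, case_names base left right]:
  assumes "(x, y) \<in> dihedral_conn \<alpha> \<beta>" and "P x"
    and "\<And>v. P v \<Longrightarrow> P (\<alpha> v)" and "\<And>v. P v \<Longrightarrow> P (\<beta> v)"
  shows "P y"
  using assms(1) unfolding dihedral_conn_def
  by (induction rule: rtrancl_induct) (use assms(2-4) in auto)

lemma dvd_iff_eq_if_less_double:
  fixes m n :: nat
  assumes "0 < m" "m < 2 * n"
  shows "n dvd m \<longleftrightarrow> m = n"
proof
  assume "n dvd m"
  then obtain c where c: "m = n * c" by blast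
  then have "0 < c" "c < 2" using assms by auto
  then show "m = n" using c by (simp add: less_2_cases_iff)
qed simp

locale two_involutions =
  fixes \<alpha> \<beta> :: "'v \<Rightarrow> 'v"
  assumes \<alpha>_\<alpha> [simp]: "\<alpha> (\<alpha> v) = v" and \<beta>_\<beta> [simp]: "\<beta> (\<beta> v) = v"
    and permutation_\<alpha>: "permutation \<alpha>" and permutation_\<beta>: "permutation \<beta>"
begin

definition endpoint :: "'v \<Rightarrow> bool" where
  "endpoint v \<longleftrightarrow> (\<alpha> v = v) \<noteq> (\<beta> v = v)"

lemma two_involutions_swap: "two_involutions \<beta> \<alpha>"
  by unfold_locales (simp_all add: permutation_\<alpha> permutation_\<beta>)

lemma conn_sym:
  assumes "(x, y) \<in> dihedral_conn \<alpha> \<beta>"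
  shows "(y, x) \<in> dihedral_conn \<alpha> \<beta>"
  using assms
proof (induction rule: dihedral_conn_induct)
  case (left v)
  then show ?case using dihedral_conn_step(1)[of "\<alpha> v" \<alpha> \<beta>] dihedral_conn_trans by simp
next
  case (right v)
  then show ?case using dihedral_conn_step(2)[of "\<beta> v" \<beta> \<alpha>] dihedral_conn_trans by simp
qed simp

lemma finite_component: "finite (dihedral_conn \<alpha> \<beta> `` {x})"
proof (rule finite_subset)
  show "dihedral_conn \<alpha> \<beta> `` {x} \<subseteq> insert x ({v. \<alpha> v \<noteq> v} \<union> {v. \<beta> v \<noteq> v})"
  proof
    fix y assume "y \<in> dihedral_conn \<alpha> \<beta> `` {x}"
    then have "(x, y) \<in> dihedral_conn \<alpha> \<beta>" by simp
    then show "y \<in> insert x ({v. \<alpha> v \<noteq> v} \<union> {v. \<beta> v \<noteq> v})"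
      by (induction rule: dihedral_conn_induct) auto
  qed
  show "finite (insert x ({v. \<alpha> v \<noteq> v} \<union> {v. \<beta> v \<noteq> v}))"
    using permutation_\<alpha> permutation_\<beta> by (simp add: permutation)
qed

definition rot :: "'v \<Rightarrow> 'v" where
  "rot v = \<beta> (\<alpha> v)"

lemma permutation_rot: "permutation rot"
  using permutation_compose[OF permutation_\<beta> permutation_\<alpha>] by (simp add: rot_def[abs_def] comp_def)

lemma rot_power_inject: "(rot ^^ k) v = (rot ^^ k) w \<longleftrightarrow> v = w"
  using permutation_rot by (metis bij_fn bij_is_inj injD permutation_bijective)

lemma rot_power_reflection: "(rot ^^ k) (\<alpha> ((rot ^^ k) v)) = \<alpha> v"
proof (induction k)
  case (Suc k)
  have "(rot ^^ Suc k) (\<alpha> ((rot ^^ Suc k) v)) = (rot ^^ k) (rot (\<alpha> (rot ((rot ^^ k) v))))"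
    by (simp add: funpow_swap1)
  also have "\<dots> = (rot ^^ k) (\<alpha> ((rot ^^ k) v))" by (simp add: rot_def)
  finally show ?case using Suc by simp
qed simp

context
  fixes x :: 'v and n :: nat
  assumes \<alpha>_x: "\<alpha> x = x"
  defines "n \<equiv> least_power rot x"
begin

lemma rot_power_eq_iff: "(rot ^^ k) x = x \<longleftrightarrow> n dvd k"
  using least_power_dvd[OF permutation_rot] by (simp add: n_def)

lemma \<alpha>_rot_power_fixed_iff: "\<alpha> ((rot ^^ k) x) = (rot ^^ k) x \<longleftrightarrow> n dvd 2 * k"
proof -
  have "\<alpha> ((rot ^^ k) x) = (rot ^^ k) x \<longleftrightarrow> (rot ^^ k) (\<alpha> ((rot ^^ k) x)) = (rot ^^ (2 * k)) x"
    by (simp add: rot_power_inject mult_2 funpow_add)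
  then show ?thesis using rot_power_eq_iff[of "2 * k"] by (auto simp: rot_power_reflection \<alpha>_x)
qed

lemma \<beta>_rot_power_fixed_iff: "\<beta> ((rot ^^ Suc k) x) = (rot ^^ Suc k) x \<longleftrightarrow> n dvd 2 * k + 1"
proof -
  have "\<beta> ((rot ^^ Suc k) x) = (rot ^^ Suc k) x
      \<longleftrightarrow> (rot ^^ k) (\<alpha> ((rot ^^ k) x)) = (rot ^^ (k + Suc k)) x"
    unfolding funpow_add comp_apply rot_power_inject by (simp add: rot_def)
  then show ?thesis
    using rot_power_eq_iff[of "k + Suc k"] unfolding rot_power_reflection \<alpha>_x
    by (auto simp: mult_2)
qed

lemma rot_power_mod: "(rot ^^ k) x = (rot ^^ (k mod n)) x"
proof -
  have "(rot ^^ k) x = (rot ^^ (k mod n)) ((rot ^^ (k - k mod n)) x)"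
    by (simp flip: comp_apply[where f = "rot ^^ (k mod n)"] funpow_add)
  then show ?thesis using rot_power_eq_iff[of "k - k mod n"] by simp
qed

lemma \<alpha>_rot_power:
  assumes "k < n"
  shows "\<alpha> ((rot ^^ k) x) = (rot ^^ (n - k)) x"
proof -
  have "(rot ^^ k) (\<alpha> ((rot ^^ k) x)) = (rot ^^ k) ((rot ^^ (n - k)) x)"
    using assms rot_power_eq_iff[of n] rot_power_reflection \<alpha>_x
    by (simp flip: comp_apply[where f = "rot ^^ k"] funpow_add)
  then show ?thesis by (simp only: rot_power_inject)
qed

lemma conn_iff_rot_power: "(x, y) \<in> dihedral_conn \<alpha> \<beta> \<longleftrightarrow> (\<exists>k<n. y = (rot ^^ k) x)"
proof
  have "n > 0" unfolding n_def by (rule least_power_of_permutation(2)[OF permutation_rot])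
  then have orbit: "\<exists>k<n. (rot ^^ m) x = (rot ^^ k) x" for m
    using rot_power_mod mod_less_divisor by blast
  show "(x, y) \<in> dihedral_conn \<alpha> \<beta> \<Longrightarrow> \<exists>k<n. y = (rot ^^ k) x"
  proof (induction rule: dihedral_conn_induct)
    case base
    show ?case using orbit[of 0] by simp
  next
    case (left v)
    then show ?case using \<alpha>_rot_power orbit by metis
  next
    case (right v)
    then obtain k where k: "k < n" "v = (rot ^^ k) x" by blast
    have "\<beta> v = rot (\<alpha> v)" by (simp add: rot_def)
    also have "\<dots> = (rot ^^ Suc (n - k)) x" using \<alpha>_rot_power k by simp
    finally show ?case using orbit[of "Suc (n - k)"] by simp
  qed
  have "(x, (rot ^^ k) x) \<in> dihedral_conn \<alpha> \<beta>" for k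
  proof (induction k)
    case (Suc k)
    have "(v, rot v) \<in> dihedral_conn \<alpha> \<beta>" for v
      unfolding rot_def by (rule dihedral_conn_trans[OF dihedral_conn_step])
    with Suc show ?case by (metis dihedral_conn_trans funpow.simps(2) comp_apply)
  qed simp
  then show "\<exists>k<n. y = (rot ^^ k) x \<Longrightarrow> (x, y) \<in> dihedral_conn \<alpha> \<beta>" by blast
qed

lemma endpoint_rot_power_iff:
  assumes "0 < k" "k < n"
  shows "endpoint ((rot ^^ k) x) \<longleftrightarrow> k = (n + 1) div 2"
proof -
  obtain j where j: "k = Suc j" using assms by (cases k) auto
  have "n dvd 2 * k \<longleftrightarrow> 2 * k = n" "n dvd 2 * j + 1 \<longleftrightarrow> 2 * j + 1 = n"
    using assms j by (simp_all add: dvd_iff_eq_if_less_double)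
  then show ?thesis
    unfolding endpoint_def \<alpha>_rot_power_fixed_iff unfolding j \<beta>_rot_power_fixed_iff by auto
qed

lemma unique_other_endpoint_if_\<alpha>_fixed:
  assumes "endpoint x"
  shows "\<exists>!y. y \<noteq> x \<and> endpoint y \<and> (x, y) \<in> dihedral_conn \<alpha> \<beta>"
proof -
  have "rot x \<noteq> x" using assms \<alpha>_x by (simp add: endpoint_def rot_def)
  then have n: "n > 1" using least_power_gt_one[OF permutation_rot] by (simp add: n_def)
  have "(y \<noteq> x \<and> endpoint y \<and> (x, y) \<in> dihedral_conn \<alpha> \<beta>) \<longleftrightarrow> y = (rot ^^ ((n + 1) div 2)) x" for y
  proof -
    have "(y \<noteq> x \<and> endpoint y \<and> (x, y) \<in> dihedral_conn \<alpha> \<beta>)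
        \<longleftrightarrow> (\<exists>k. 0 < k \<and> k < n \<and> y = (rot ^^ k) x \<and> endpoint ((rot ^^ k) x))"
      using rot_power_eq_iff nat_dvd_not_less unfolding conn_iff_rot_power
      by (metis bot_nat_0.not_eq_extremum dvd_0_right)
    also have "\<dots> \<longleftrightarrow> y = (rot ^^ ((n + 1) div 2)) x"
      using endpoint_rot_power_iff n by (auto intro!: exI[of _ "(n + 1) div 2"])
    finally show ?thesis .
  qed
  then show ?thesis by simp
qed

end

lemma unique_other_endpoint:
  assumes "endpoint x"
  shows "\<exists>!y. y \<noteq> x \<and> endpoint y \<and> (x, y) \<in> dihedral_conn \<alpha> \<beta>"
proof (cases "\<alpha> x = x")
  case True
  then show ?thesis using assms by (rule unique_other_endpoint_if_\<alpha>_fixed)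
next
  case False
  interpret swap: two_involutions \<beta> \<alpha> by (rule two_involutions_swap)
  have "swap.endpoint = endpoint" by (auto simp: fun_eq_iff endpoint_def swap.endpoint_def)
  moreover have "\<beta> x = x" using False assms by (simp add: endpoint_def)
  ultimately show ?thesis
    using swap.unique_other_endpoint_if_\<alpha>_fixed[of x] assms
    by (simp add: dihedral_conn_commute[of \<beta> \<alpha>])
qed

lemma endpoints_in_component:
  assumes "endpoint x" "endpoint y" "y \<noteq> x" "(x, y) \<in> dihedral_conn \<alpha> \<beta>"
  shows "{v \<in> dihedral_conn \<alpha> \<beta> `` {x}. endpoint v} = {x, y}"
  using unique_other_endpoint[OF assms(1)] assms by auto

lemma sum_alternating_eq_sum_fixed:
  fixes e :: "'v \<Rightarrow> 'a :: ab_group_add"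
  assumes "\<And>v. \<alpha> v \<noteq> v \<Longrightarrow> e (\<alpha> v) = - e v"
    and "finite C" and "\<And>v. v \<in> C \<Longrightarrow> \<alpha> v \<in> C"
  shows "sum e C = sum e {v \<in> C. \<alpha> v = v}"
proof -
  have "sum e {v \<in> C. \<alpha> v \<noteq> v} = 0"
    by (rule sum_involution_eq_0[where h = \<alpha>]) (use assms in auto)
  moreover have "sum e C = sum e {v \<in> C. \<alpha> v = v} + sum e {v \<in> C. \<alpha> v \<noteq> v}"
    using \<open>finite C\<close> by (subst sum.union_disjoint[symmetric]) (auto intro: sum.cong)
  ultimately show ?thesis by simp
qed

text \<open>Each involution cancels the signs in a component except at its own fixed points, so the fixed
  points of \<open>\<alpha>\<close> and those of \<open>\<beta>\<close> contribute the same sum.\<close>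

lemma alternating_sign_at_endpoints:
  fixes e :: "'v \<Rightarrow> 'a :: ab_group_add"
  assumes alternating: "\<And>v. \<alpha> v \<noteq> v \<Longrightarrow> e (\<alpha> v) = - e v" "\<And>v. \<beta> v \<noteq> v \<Longrightarrow> e (\<beta> v) = - e v"
    and ends: "endpoint x" "endpoint y" "y \<noteq> x" "(x, y) \<in> dihedral_conn \<alpha> \<beta>"
  shows "e y = (if \<alpha> x = x \<longleftrightarrow> \<alpha> y = y then - e x else e x)"
proof -
  define C where "C = dihedral_conn \<alpha> \<beta> `` {x}"
  have closed: "\<alpha> v \<in> C" "\<beta> v \<in> C" if "v \<in> C" for v
    using that unfolding C_def by (auto intro: dihedral_conn_trans dihedral_conn_step)
  interpret swap: two_involutions \<beta> \<alpha> by (rule two_involutions_swap)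
  have "sum e {v \<in> C. \<alpha> v = v} = sum e {v \<in> C. \<beta> v = v}"
    using sum_alternating_eq_sum_fixed[of e C, OF alternating(1)]
      swap.sum_alternating_eq_sum_fixed[of e C, OF alternating(2)] closed finite_component
    by (simp add: C_def)
  moreover have "\<alpha> v \<noteq> v \<or> \<beta> v \<noteq> v" if v: "v \<in> C" for v
  proof (rule ccontr)
    assume isolated: "\<not> (\<alpha> v \<noteq> v \<or> \<beta> v \<noteq> v)"
    have "(v, x) \<in> dihedral_conn \<alpha> \<beta>" using v conn_sym by (simp add: C_def)
    then have "x = v" by (induction rule: dihedral_conn_induct) (use isolated in auto)
    then show False using isolated ends(1) by (simp add: endpoint_def)
  qed
  then have "{v \<in> C. \<alpha> v = v} = {v \<in> {v \<in> C. endpoint v}. \<alpha> v = v}"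
    "{v \<in> C. \<beta> v = v} = {v \<in> {v \<in> C. endpoint v}. \<alpha> v \<noteq> v}"
    by (auto simp: endpoint_def)
  then have "{v \<in> C. \<alpha> v = v} = {v \<in> {x, y}. \<alpha> v = v}" "{v \<in> C. \<beta> v = v} = {v \<in> {x, y}. \<alpha> v \<noteq> v}"
    by (simp_all only: endpoints_in_component[OF ends, folded C_def])
  ultimately have "sum e {v \<in> {x, y}. \<alpha> v = v} = sum e {v \<in> {x, y}. \<alpha> v \<noteq> v}"
    by simp
  then have "(\<Sum>v\<in>{x, y}. if \<alpha> v = v then e v else 0) = (\<Sum>v\<in>{x, y}. if \<alpha> v \<noteq> v then e v else 0)"
    by (simp only: sum.inter_filter finite.intros)
  then show ?thesis
    using \<open>y \<noteq> x\<close> by (auto simp: eq_neg_iff_add_eq_0 add.commute split: if_splits)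
qed

end

section \<open>Concatenation of diagrams\<close>

lemma brauer_diagrams_closed: "m \<in> brauer_diagrams d \<Longrightarrow> p \<in> pts d \<Longrightarrow> m p \<in> pts d"
  by (simp add: brauer_diagrams_def)

lemma brauer_diagrams_neq: "m \<in> brauer_diagrams d \<Longrightarrow> p \<in> pts d \<Longrightarrow> m p \<noteq> p"
  by (simp add: brauer_diagrams_def)

lemma brauer_diagrams_outside: "m \<in> brauer_diagrams d \<Longrightarrow> p \<notin> pts d \<Longrightarrow> m p = p"
  unfolding brauer_diagrams_def by blast

lemma brauer_diagrams_involution: "m \<in> brauer_diagrams d \<Longrightarrow> m (m p) = p"
  using brauer_diagrams_outside[of m d p] by (cases "p \<in> pts d") (auto simp: brauer_diagrams_def)

lemma involution_imp_permutes:
  assumes "\<And>x. f (f x) = x" and "\<And>x. x \<notin> S \<Longrightarrow> f x = x"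
  shows "f permutes S"
  unfolding permutes_def using assms by metis

lemma finite_pts: "finite (pts d)"
  by (simp add: pts_def)

lemma finite_brauer_diagrams: "finite (brauer_diagrams d)"
proof (rule finite_subset)
  show "brauer_diagrams d \<subseteq> {m. m permutes pts d}"
    using brauer_diagrams_involution brauer_diagrams_outside by (blast intro: involution_imp_permutes)
  show "finite {m. m permutes pts d}"
    using finite_pts by (rule finite_permutations)
qed

definition level :: "nat \<Rightarrow> bool \<times> nat \<Rightarrow> nat \<times> nat" where
  "level i p = (if fst p then i else Suc i, snd p)"

lemma lvl_a_eq_level: "lvl_a = level 0"
  by (simp add: fun_eq_iff lvl_a_def level_def)

lemma lvl_b_eq_level: "lvl_b = level (Suc 0)"
  by (simp add: fun_eq_iff lvl_b_def level_def)

lemma level_image_pts: "level i ` pts d = {i, Suc i} \<times> {..<d}"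
proof
  have "v = level i (fst v = i, snd v) \<and> (fst v = i, snd v) \<in> pts d" if "v \<in> {i, Suc i} \<times> {..<d}" for v
    using that by (auto simp: level_def pts_def)
  then show "{i, Suc i} \<times> {..<d} \<subseteq> level i ` pts d" by blast
qed (auto simp: level_def pts_def)

lemma inj_level: "inj (level i)"
  by (auto simp: inj_def level_def prod_eq_iff split: if_splits)

definition strand :: "nat \<Rightarrow> nat \<Rightarrow> diagram \<Rightarrow> nat \<times> nat \<Rightarrow> nat \<times> nat" where
  "strand d i m v = (if v \<in> level i ` pts d then level i (m (fst v = i, snd v)) else v)"

lemma strand_level:
  assumes "p \<in> pts d"
  shows "strand d i m (level i p) = level i (m p)"
proof -
  have "(fst (level i p) = i, snd (level i p)) = p" by (auto simp: level_def prod_eq_iff)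
  then show ?thesis using assms by (simp add: strand_def)
qed

lemma strand_outside: "v \<notin> level i ` pts d \<Longrightarrow> strand d i m v = v"
  by (simp add: strand_def)

lemma strand_fixed_iff:
  assumes "m \<in> brauer_diagrams d"
  shows "strand d i m v = v \<longleftrightarrow> v \<notin> level i ` pts d"
proof
  show "v \<notin> level i ` pts d" if "strand d i m v = v"
    using that assms brauer_diagrams_neq by (auto simp: strand_level inj_eq[OF inj_level])
qed (rule strand_outside)

lemma strand_involution:
  assumes "m \<in> brauer_diagrams d"
  shows "strand d i m (strand d i m v) = v"
proof (cases "v \<in> level i ` pts d")
  case True
  then obtain p where "p \<in> pts d" "v = level i p" by blast
  then show ?thesis
    using assms by (simp add: strand_level brauer_diagrams_closed brauer_diagrams_involution)
qed (simp add: strand_outside)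

lemma permutation_strand:
  assumes "m \<in> brauer_diagrams d"
  shows "permutation (strand d i m)"
proof (rule permutes_imp_permutation)
  show "strand d i m permutes level i ` pts d"
    using strand_involution[OF assms] strand_outside by (rule involution_imp_permutes)
qed (simp add: finite_pts)

definition strand_edges :: "nat \<Rightarrow> nat \<Rightarrow> diagram \<Rightarrow> ((nat \<times> nat) \<times> (nat \<times> nat)) set" where
  "strand_edges d i m = (\<lambda>p. (level i p, level i (m p))) ` pts d"

lemma strand_edges_imp_strand: "(v, w) \<in> strand_edges d i m \<Longrightarrow> w = strand d i m v"
  by (auto simp: strand_edges_def strand_level)

lemma strand_in_strand_edges: "(v, strand d i m v) \<in> (strand_edges d i m)\<^sup>="
proof (cases "v \<in> level i ` pts d")
  case True
  then show ?thesis by (auto simp: strand_edges_def strand_level)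
qed (simp add: strand_outside)

lemma stack_edges_eq: "stack_edges d a b = strand_edges d 0 a \<union> strand_edges d (Suc 0) b"
  by (auto simp: stack_edges_def strand_edges_def lvl_a_eq_level lvl_b_eq_level)

lemma unlvl_lvl_out [simp]: "unlvl (lvl_out p) = p"
  by (cases p) (auto simp: unlvl_def lvl_out_def)

lemma lvl_out_unlvl: "outer d v \<Longrightarrow> lvl_out (unlvl v) = v"
  by (cases v) (auto simp: unlvl_def lvl_out_def outer_def)

lemma lvl_out_inject: "lvl_out p = lvl_out q \<longleftrightarrow> p = q"
  by (metis unlvl_lvl_out)

lemma outer_lvl_out_iff: "outer d (lvl_out p) \<longleftrightarrow> p \<in> pts d"
  by (cases p) (auto simp: outer_def lvl_out_def pts_def)

lemma outerE:
  assumes "outer d v"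
  obtains p where "p \<in> pts d" "v = lvl_out p"
  using assms lvl_out_unlvl outer_lvl_out_iff by metis

locale stack =
  fixes d :: nat and a b :: diagram
  assumes upper_diagram: "a \<in> brauer_diagrams d" and lower_diagram: "b \<in> brauer_diagrams d"
begin

abbreviation upper :: "nat \<times> nat \<Rightarrow> nat \<times> nat" where "upper \<equiv> strand d 0 a"
abbreviation lower :: "nat \<times> nat \<Rightarrow> nat \<times> nat" where "lower \<equiv> strand d (Suc 0) b"
abbreviation conn :: "((nat \<times> nat) \<times> (nat \<times> nat)) set" where "conn \<equiv> stack_conn d a b"

sublocale two_involutions upper lower
  by unfold_locales (simp_all add: upper_diagram lower_diagram strand_involution permutation_strand)

lemma stack_conn_eq_dihedral_conn: "conn = dihedral_conn upper lower"
  unfolding stack_conn_def dihedral_conn_def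
proof (rule rtrancl_subset[symmetric])
  have "w = upper v \<or> w = lower v" if "(v, w) \<in> stack_edges d a b" for v w
    using that unfolding stack_edges_eq by (blast dest: strand_edges_imp_strand)
  then show "stack_edges d a b \<union> (stack_edges d a b)\<inverse> \<subseteq> {(v, w). w = upper v \<or> w = lower v}"
    by fastforce
  have "(v, upper v) \<in> (stack_edges d a b)\<^sup>=" "(v, lower v) \<in> (stack_edges d a b)\<^sup>=" for v
    unfolding stack_edges_eq using strand_in_strand_edges by blast+
  moreover have "(stack_edges d a b)\<^sup>= \<subseteq> (stack_edges d a b \<union> (stack_edges d a b)\<inverse>)\<^sup>*"
    by auto
  ultimately have "(v, upper v) \<in> (stack_edges d a b \<union> (stack_edges d a b)\<inverse>)\<^sup>*"
    "(v, lower v) \<in> (stack_edges d a b \<union> (stack_edges d a b)\<inverse>)\<^sup>*" for v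
    by (meson subsetD)+
  then show "{(v, w). w = upper v \<or> w = lower v} \<subseteq> (stack_edges d a b \<union> (stack_edges d a b)\<inverse>)\<^sup>*"
    by auto
qed

lemma stack_conn_refl [simp]: "(x, x) \<in> conn"
  by (simp add: stack_conn_def)

lemma stack_conn_sym: "(x, y) \<in> conn \<Longrightarrow> (y, x) \<in> conn"
  unfolding stack_conn_eq_dihedral_conn by (rule conn_sym)

lemma stack_conn_class_eq: "(x, y) \<in> conn \<Longrightarrow> conn `` {x} = conn `` {y}"
  using stack_conn_sym unfolding stack_conn_def by (blast intro: rtrancl_trans)

lemma upper_fixed_iff: "upper v = v \<longleftrightarrow> v \<notin> {0, 1} \<times> {..<d}"
  using strand_fixed_iff[OF upper_diagram, of 0 v] by (simp add: level_image_pts)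

lemma lower_fixed_iff: "lower v = v \<longleftrightarrow> v \<notin> {1, 2} \<times> {..<d}"
  using strand_fixed_iff[OF lower_diagram, of "Suc 0" v] by (simp add: level_image_pts numeral_2_eq_2)

lemma endpoint_iff_outer: "endpoint v \<longleftrightarrow> outer d v"
  unfolding endpoint_def upper_fixed_iff lower_fixed_iff by (cases v) (auto simp: outer_def)

lemma compose_properties:
  assumes "p \<in> pts d"
  shows "compose d a b p \<in> pts d" "compose d a b p \<noteq> p"
    "(lvl_out p, lvl_out (compose d a b p)) \<in> conn"
proof -
  define w where "w = (THE w. w \<noteq> lvl_out p \<and> outer d w \<and> (lvl_out p, w) \<in> conn)"
  have "\<exists>!w. w \<noteq> lvl_out p \<and> outer d w \<and> (lvl_out p, w) \<in> conn"
    using unique_other_endpoint[of "lvl_out p"] assms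
    by (simp add: endpoint_iff_outer outer_lvl_out_iff stack_conn_eq_dihedral_conn)
  then have w: "w \<noteq> lvl_out p \<and> outer d w \<and> (lvl_out p, w) \<in> conn"
    unfolding w_def by (rule theI')
  moreover have "lvl_out (compose d a b p) = w"
    using assms w lvl_out_unlvl[of d w] by (simp add: compose_def flip: w_def)
  ultimately show "compose d a b p \<in> pts d" "compose d a b p \<noteq> p"
    "(lvl_out p, lvl_out (compose d a b p)) \<in> conn"
    by (auto simp: outer_lvl_out_iff)
qed

lemma outer_in_component:
  assumes "p \<in> pts d"
  shows "{v \<in> conn `` {lvl_out p}. outer d v} = {lvl_out p, lvl_out (compose d a b p)}"
  using endpoints_in_component[of "lvl_out p" "lvl_out (compose d a b p)"]
    compose_properties[OF assms] assms
  by (simp add: endpoint_iff_outer outer_lvl_out_iff stack_conn_eq_dihedral_conn lvl_out_inject)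

lemma compose_eqI:
  assumes "p \<in> pts d" "q \<in> pts d" "q \<noteq> p" "(lvl_out p, lvl_out q) \<in> conn"
  shows "compose d a b p = q"
proof -
  have "lvl_out q \<in> {v \<in> conn `` {lvl_out p}. outer d v}"
    using assms by (simp add: outer_lvl_out_iff)
  then show ?thesis
    unfolding outer_in_component[OF assms(1)] using assms(3) by (auto simp: lvl_out_inject)
qed

lemma compose_in_brauer_diagrams: "compose d a b \<in> brauer_diagrams d"
  unfolding brauer_diagrams_def
proof (intro CollectI conjI ballI allI impI)
  fix p assume p: "p \<in> pts d"
  show "compose d a b p \<in> pts d" "compose d a b p \<noteq> p" using compose_properties[OF p] by auto
  then show "compose d a b (compose d a b p) = p"
    using p stack_conn_sym[OF compose_properties(3)[OF p]] by (intro compose_eqI) auto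
qed (simp add: compose_def)

end

lemma compose_brauer_diagrams:
  "a \<in> brauer_diagrams d \<Longrightarrow> b \<in> brauer_diagrams d \<Longrightarrow> compose d a b \<in> brauer_diagrams d"
  by (rule stack.compose_in_brauer_diagrams) (rule stack.intro)

lemma id_diagram_in_brauer_diagrams: "id_diagram d \<in> brauer_diagrams d"
  by (auto simp: brauer_diagrams_def id_diagram_def pts_def)

section \<open>Diagrams acting on tensor powers\<close>

definition label :: "nat set \<Rightarrow> nat set \<Rightarrow> bool \<times> nat \<Rightarrow> bool" where
  "label f g p \<longleftrightarrow> snd p \<in> (if fst p then f else g)"

definition stack_label :: "nat set \<Rightarrow> nat set \<Rightarrow> nat set \<Rightarrow> nat \<times> nat \<Rightarrow> bool" where
  "stack_label f g h v \<longleftrightarrow> snd v \<in> (if fst v = 0 then f else if fst v = 1 then g else h)"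

definition compatible :: "nat \<Rightarrow> diagram \<Rightarrow> nat set \<Rightarrow> nat set \<Rightarrow> bool" where
  "compatible d m f g \<longleftrightarrow> (\<forall>p\<in>pts d. label f g (m p) = label f g p)"

lemma stack_label_level:
  "stack_label f g h (level 0 p) = label f g p"
  "stack_label f g h (level (Suc 0) p) = label g h p"
  by (simp_all add: stack_label_def label_def level_def)

lemma stack_label_lvl_out: "stack_label f g h (lvl_out p) = label f h p"
  by (simp add: stack_label_def label_def lvl_out_def)

lemma stack_label_outer: "outer d v \<Longrightarrow> stack_label f g h v = stack_label f g' h v"
  by (simp add: stack_label_def outer_def)

lemma strand_invariantI:
  assumes "\<And>p. p \<in> pts d \<Longrightarrow> P (level i (m p)) = P (level i p)"
  shows "P (strand d i m v) = P v"
  using assms by (cases "v \<in> level i ` pts d") (auto simp: strand_level strand_outside)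

context stack
begin

lemma compatible_imp_stack_label_eq:
  assumes "compatible d a f g" "compatible d b g h" and "(x, y) \<in> conn"
  shows "stack_label f g h y = stack_label f g h x"
proof -
  have "stack_label f g h (upper v) = stack_label f g h v"
    "stack_label f g h (lower v) = stack_label f g h v" for v
    by (rule strand_invariantI; use assms(1,2) in \<open>simp add: compatible_def stack_label_level\<close>)+
  with assms(3) show ?thesis
    unfolding stack_conn_eq_dihedral_conn by (induction rule: dihedral_conn_induct) auto
qed

lemma compatible_if_class_function:
  assumes L: "\<And>x y. (x, y) \<in> conn \<Longrightarrow> L x = L y"
    and stack_label: "\<And>v. v \<in> {..2} \<times> {..<d} \<Longrightarrow> stack_label f g h v = L v"
  shows "compatible d a f g" "compatible d b g h"
proof -
  have "stack_label f g h w = stack_label f g h v"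
    if "(v, w) \<in> conn" "v \<in> {..2} \<times> {..<d}" "w \<in> {..2} \<times> {..<d}" for v w
    using L[OF that(1)] stack_label that(2,3) by simp
  moreover have "(level 0 p, level 0 (a p)) \<in> conn" "(level (Suc 0) p, level (Suc 0) (b p)) \<in> conn"
    if "p \<in> pts d" for p
    unfolding stack_conn_eq_dihedral_conn strand_level[OF that, symmetric] by (rule dihedral_conn_step)+
  moreover have "level i p \<in> {..2} \<times> {..<d}" if "i \<le> 1" "p \<in> pts d" for i p
    using that by (auto simp: level_def pts_def)
  ultimately have "stack_label f g h (level 0 (a p)) = stack_label f g h (level 0 p)"
    "stack_label f g h (level (Suc 0) (b p)) = stack_label f g h (level (Suc 0) p)" if "p \<in> pts d" for p
    using that upper_diagram lower_diagram brauer_diagrams_closed by simp_all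
  then show "compatible d a f g" "compatible d b g h"
    by (simp_all add: compatible_def stack_label_level)
qed

lemma compatible_compose:
  assumes "compatible d a f g" "compatible d b g h"
  shows "compatible d (compose d a b) f h"
  unfolding compatible_def stack_label_lvl_out[of f g h, symmetric]
  using compatible_imp_stack_label_eq[OF assms] compose_properties(3) by blast

definition loop_classes :: "(nat \<times> nat) set set" where
  "loop_classes = {conn `` {v} | v. fst v = 1 \<and> snd v < d \<and> (\<forall>w \<in> conn `` {v}. \<not> outer d w)}"

lemma loops_eq_card_loop_classes: "loops d a b = card loop_classes"
  by (simp add: loops_def loop_classes_def)

lemma finite_loop_classes: "finite loop_classes"
proof (rule finite_subset)
  show "loop_classes \<subseteq> (\<lambda>v. conn `` {v}) ` ({1} \<times> {..<d})"
    by (force simp: loop_classes_def)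
qed simp

lemma loop_classE:
  assumes "C \<in> loop_classes"
  obtains i where "i < d" "C = conn `` {(1, i)}"
  using assms by (auto simp: loop_classes_def)

lemma middle_class_in_loop_classes_iff:
  assumes "i < d"
  shows "conn `` {(1, i)} \<in> loop_classes \<longleftrightarrow> (\<forall>w \<in> conn `` {(1, i)}. \<not> outer d w)"
  using assms by (auto simp: loop_classes_def)

lemma loop_class_not_outer: "C \<in> loop_classes \<Longrightarrow> w \<in> C \<Longrightarrow> \<not> outer d w"
  by (auto simp: loop_classes_def)

definition middle_labels :: "nat set \<Rightarrow> nat set \<Rightarrow> nat set set" where
  "middle_labels f h = {g \<in> Pow {..<d}. compatible d a f g \<and> compatible d b g h}"

lemma middle_labels_constant:
  assumes "g \<in> middle_labels f h" "(x, y) \<in> conn"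
  shows "stack_label f g h y = stack_label f g h x"
  using assms compatible_imp_stack_label_eq by (simp add: middle_labels_def)

definition marked_loops :: "nat set \<Rightarrow> (nat \<times> nat) set set" where
  "marked_loops g = {C \<in> loop_classes. \<exists>i\<in>g. (1, i) \<in> C}"

lemma marked_loops_subset_imp_subset:
  assumes g: "g \<in> middle_labels f h" and g': "g' \<in> middle_labels f h"
    and marked: "marked_loops g \<subseteq> marked_loops g'"
  shows "g \<subseteq> g'"
proof
  fix i assume i: "i \<in> g"
  then have "i < d" using g by (auto simp: middle_labels_def)
  show "i \<in> g'"
  proof (cases "conn `` {(1, i)} \<in> loop_classes")
    case True
    then have "conn `` {(1, i)} \<in> marked_loops g"
      using i by (auto simp: marked_loops_def intro: bexI[of _ i])
    then have "conn `` {(1, i)} \<in> marked_loops g'" using marked by blast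
    then obtain j where "j \<in> g'" "((1, i), (1, j)) \<in> conn" by (auto simp: marked_loops_def)
    then show ?thesis using middle_labels_constant[OF g'] by (fastforce simp: stack_label_def)
  next
    case False
    then obtain w where w: "((1, i), w) \<in> conn" "outer d w"
      using middle_class_in_loop_classes_iff[OF \<open>i < d\<close>] by blast
    have "stack_label f g h (1, i) = stack_label f g' h (1, i)"
      using middle_labels_constant[OF g w(1)] middle_labels_constant[OF g' w(1)]
        stack_label_outer[OF w(2)] by blast
    then show ?thesis using i by (simp add: stack_label_def)
  qed
qed

definition class_label :: "nat set \<Rightarrow> nat set \<Rightarrow> (nat \<times> nat) set set \<Rightarrow> nat \<times> nat \<Rightarrow> bool" where
  "class_label f h S v \<longleftrightarrow> conn `` {v} \<in> S \<or> (\<exists>w \<in> conn `` {v}. outer d w \<and> stack_label f {} h w)"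

lemma class_label_constant: "(x, y) \<in> conn \<Longrightarrow> class_label f h S x = class_label f h S y"
  unfolding class_label_def by (simp add: stack_conn_class_eq)

lemma class_label_outer:
  assumes "compatible d (compose d a b) f h" "S \<subseteq> loop_classes" "outer d v"
  shows "class_label f h S v = stack_label f g h v"
proof -
  obtain p where p: "p \<in> pts d" "v = lvl_out p" using assms(3) by (rule outerE)
  have "conn `` {v} \<notin> S" using assms(2,3) loop_class_not_outer[of "conn `` {v}" v] by auto
  then have "class_label f h S v \<longleftrightarrow> (\<exists>w \<in> {w \<in> conn `` {v}. outer d w}. stack_label f {} h w)"
    by (auto simp: class_label_def)
  also have "\<dots> \<longleftrightarrow> label f h p"
    using assms(1) p(1) unfolding p(2) outer_in_component[OF p(1)]
    by (auto simp: stack_label_lvl_out compatible_def)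
  finally show ?thesis by (simp add: p(2) stack_label_lvl_out)
qed

lemma exists_middle_label_marking:
  assumes compatible: "compatible d (compose d a b) f h" and S: "S \<subseteq> loop_classes"
  shows "\<exists>g \<in> middle_labels f h. marked_loops g = S"
proof
  define g where "g = {i. i < d \<and> class_label f h S (1, i)}"
  have "stack_label f g h v = class_label f h S v" if "v \<in> {..2} \<times> {..<d}" for v
  proof (cases "fst v = 1")
    case True
    then have "v = (1, snd v)" by (simp add: prod_eq_iff)
    with that have "class_label f h S v \<longleftrightarrow> snd v \<in> g" by (auto simp: g_def)
    then show ?thesis by (simp add: stack_label_def True)
  next
    case False
    then have "outer d v" using that by (auto simp: outer_def)
    then show ?thesis using class_label_outer[OF compatible S] by simp
  qed
  then show "g \<in> middle_labels f h"
    using compatible_if_class_function[of "class_label f h S" f g h, OF class_label_constant]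
    by (auto simp: middle_labels_def g_def)
  show "marked_loops g = S"
  proof (intro equalityI subsetI)
    fix C assume "C \<in> marked_loops g"
    then obtain i where i: "i < d" "class_label f h S (1, i)" "C \<in> loop_classes" "(1, i) \<in> C"
      by (auto simp: marked_loops_def g_def)
    then have "C = conn `` {(1, i)}" by (metis Image_singleton_iff loop_classE stack_conn_class_eq)
    then show "C \<in> S" using i middle_class_in_loop_classes_iff by (auto simp: class_label_def)
  next
    fix C assume "C \<in> S"
    then obtain i where "i < d" "C = conn `` {(1, i)}" using S loop_classE by blast
    then show "C \<in> marked_loops g"
      using \<open>C \<in> S\<close> S by (auto simp: marked_loops_def g_def class_label_def)
  qed
qed

lemma card_middle_labels:
  assumes "compatible d (compose d a b) f h"
  shows "card (middle_labels f h) = 2 ^ loops d a b"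
proof -
  have "inj_on marked_loops (middle_labels f h)"
    by (rule inj_onI) (simp add: marked_loops_subset_imp_subset subset_antisym)
  moreover have "marked_loops ` middle_labels f h = Pow loop_classes"
  proof
    show "Pow loop_classes \<subseteq> marked_loops ` middle_labels f h"
      using exists_middle_label_marking[OF assms] by blast
  qed (auto simp: marked_loops_def)
  ultimately have "card (middle_labels f h) = card (Pow loop_classes)"
    by (metis card_image)
  then show ?thesis by (simp add: card_Pow finite_loop_classes loops_eq_card_loop_classes)
qed

end

text \<open>\<open>tensor_entry d m f g\<close> is the matrix entry at \<open>(f, g)\<close> of the diagram \<open>m\<close> acting on the
  \<open>d\<close>-th tensor power of a two-dimensional space with an orthonormal basis.\<close>

definition tensor_entry :: "nat \<Rightarrow> diagram \<Rightarrow> nat set \<Rightarrow> nat set \<Rightarrow> nat" where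
  "tensor_entry d m f g = of_bool (compatible d m f g)"

lemma sum_tensor_entry_mult:
  assumes a: "a \<in> brauer_diagrams d" and b: "b \<in> brauer_diagrams d"
  shows "(\<Sum>g\<in>Pow {..<d}. tensor_entry d a f g * tensor_entry d b g h)
    = 2 ^ loops d a b * tensor_entry d (compose d a b) f h"
proof -
  interpret stack d a b using assms by (rule stack.intro)
  have "(\<Sum>g\<in>Pow {..<d}. tensor_entry d a f g * tensor_entry d b g h) = card (middle_labels f h)"
    by (simp add: tensor_entry_def middle_labels_def of_bool_conj[symmetric] sum_of_bool_eq Int_def)
  also have "\<dots> = 2 ^ loops d a b * tensor_entry d (compose d a b) f h"
  proof (cases "compatible d (compose d a b) f h")
    case True
    then show ?thesis by (simp add: card_middle_labels tensor_entry_def)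
  next
    case False
    then have "middle_labels f h = {}" using compatible_compose by (auto simp: middle_labels_def)
    with False show ?thesis by (simp add: tensor_entry_def)
  qed
  finally show ?thesis .
qed

lemma tensor_entry_all: "m \<in> brauer_diagrams d \<Longrightarrow> tensor_entry d m {..<d} {..<d} = 1"
  using brauer_diagrams_closed[of m d]
  by (auto simp: tensor_entry_def compatible_def label_def pts_def mem_Times_iff)

lemma tensor_entry_id_diagram:
  "f \<subseteq> {..<d} \<Longrightarrow> g \<subseteq> {..<d} \<Longrightarrow> tensor_entry d (id_diagram d) f g = of_bool (f = g)"
  by (auto simp: tensor_entry_def compatible_def label_def id_diagram_def pts_def)

lemma compatible_imp_eq:
  assumes x: "x \<in> brauer_diagrams d" and y: "y \<in> brauer_diagrams d"
    and imp: "\<And>f g. f \<subseteq> {..<d} \<Longrightarrow> g \<subseteq> {..<d} \<Longrightarrow> compatible d x f g \<Longrightarrow> compatible d y f g"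
  shows "x = y"
proof
  fix p
  show "x p = y p"
  proof (cases "p \<in> pts d")
    case True
    define f where "f = {i. (True, i) \<in> {p, x p}}"
    define g where "g = {i. (False, i) \<in> {p, x p}}"
    have label: "label f g q \<longleftrightarrow> q \<in> {p, x p}" for q
      by (cases q) (auto simp: label_def f_def g_def)
    have "x p \<in> pts d" using x True by (rule brauer_diagrams_closed)
    then have "f \<subseteq> {..<d}" "g \<subseteq> {..<d}" using True by (auto simp: f_def g_def pts_def)
    moreover have "compatible d x f g"
      unfolding compatible_def label using brauer_diagrams_involution[OF x] by (metis insert_iff singletonD)
    ultimately have "compatible d y f g" by (rule imp)
    then have "y p \<in> {p, x p}" using True label unfolding compatible_def by blast
    then show ?thesis using brauer_diagrams_neq[OF y True] by auto
  next
    case False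
    then show ?thesis using x y brauer_diagrams_outside by metis
  qed
qed

lemma tensor_entry_faithful:
  assumes x: "x \<in> brauer_diagrams d" and y: "y \<in> brauer_diagrams d"
    and eq: "\<And>f g. f \<subseteq> {..<d} \<Longrightarrow> g \<subseteq> {..<d}
      \<Longrightarrow> 2 ^ k * tensor_entry d x f g = 2 ^ l * tensor_entry d y f g"
  shows "x = y \<and> k = l"
proof
  show "k = l" using eq[of "{..<d}" "{..<d}"] by (simp add: tensor_entry_all x y)
  show "x = y"
  proof (rule compatible_imp_eq[OF x y])
    fix f g assume "f \<subseteq> {..<d}" "g \<subseteq> {..<d}" "compatible d x f g"
    then show "compatible d y f g" 
      using eq[of f g] by (cases "compatible d y f g") (auto simp: tensor_entry_def)
  qed
qed

theorem compose_assoc_loops: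
  assumes a: "a \<in> brauer_diagrams d" and b: "b \<in> brauer_diagrams d" and c: "c \<in> brauer_diagrams d"
  shows "compose d (compose d a b) c = compose d a (compose d b c)
    \<and> loops d a b + loops d (compose d a b) c = loops d b c + loops d a (compose d b c)"
proof (rule tensor_entry_faithful)
  show "compose d (compose d a b) c \<in> brauer_diagrams d" "compose d a (compose d b c) \<in> brauer_diagrams d"
    using assms by (simp_all add: compose_brauer_diagrams)
  fix f h :: "nat set"
  let ?X = "Pow {..<d}" and ?t = "tensor_entry d"
  note mult = sum_tensor_entry_mult[OF compose_brauer_diagrams[OF a b] c]
    sum_tensor_entry_mult[OF a b] sum_tensor_entry_mult[OF b c]
    sum_tensor_entry_mult[OF a compose_brauer_diagrams[OF b c]]
  have "2 ^ (loops d a b + loops d (compose d a b) c) * ?t (compose d (compose d a b) c) f h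
      = (\<Sum>k\<in>?X. (\<Sum>g\<in>?X. ?t a f g * ?t b g k) * ?t c k h)"
    by (simp add: power_add mult mult.assoc flip: sum_distrib_left)
  also have "\<dots> = (\<Sum>k\<in>?X. \<Sum>g\<in>?X. ?t a f g * (?t b g k * ?t c k h))"
    by (simp only: sum_distrib_right mult.assoc)
  also have "\<dots> = (\<Sum>g\<in>?X. ?t a f g * (\<Sum>k\<in>?X. ?t b g k * ?t c k h))"
    by (subst sum.swap) (simp only: sum_distrib_left)
  also have "\<dots> = 2 ^ (loops d b c + loops d a (compose d b c)) * ?t (compose d a (compose d b c)) f h"
    by (simp add: power_add mult mult.assoc mult.left_commute[of "?t a f _"] flip: sum_distrib_left)
  finally show "2 ^ (loops d a b + loops d (compose d a b) c) * ?t (compose d (compose d a b) c) f h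
      = 2 ^ (loops d b c + loops d a (compose d b c)) * ?t (compose d a (compose d b c)) f h" .
qed

lemma compose_id_diagram_left:
  assumes a: "a \<in> brauer_diagrams d"
  shows "compose d (id_diagram d) a = a \<and> loops d (id_diagram d) a = 0"
proof (rule tensor_entry_faithful)
  fix f h assume "f \<subseteq> {..<d}" "h \<subseteq> {..<d}"
  then have "(\<Sum>g\<in>Pow {..<d}. tensor_entry d (id_diagram d) f g * tensor_entry d a g h)
      = (\<Sum>g\<in>Pow {..<d}. if g = f then tensor_entry d a f h else 0)"
    by (intro sum.cong) (auto simp: tensor_entry_id_diagram)
  then show "2 ^ loops d (id_diagram d) a * tensor_entry d (compose d (id_diagram d) a) f h
      = 2 ^ 0 * tensor_entry d a f h"
    using \<open>f \<subseteq> {..<d}\<close> by (simp add: sum_tensor_entry_mult id_diagram_in_brauer_diagrams a)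
qed (simp_all add: a compose_brauer_diagrams id_diagram_in_brauer_diagrams)

lemma compose_id_diagram_right:
  assumes a: "a \<in> brauer_diagrams d"
  shows "compose d a (id_diagram d) = a \<and> loops d a (id_diagram d) = 0"
proof (rule tensor_entry_faithful)
  fix f h assume "f \<subseteq> {..<d}" "h \<subseteq> {..<d}"
  then have "(\<Sum>g\<in>Pow {..<d}. tensor_entry d a f g * tensor_entry d (id_diagram d) g h)
      = (\<Sum>g\<in>Pow {..<d}. if g = h then tensor_entry d a f h else 0)"
    by (intro sum.cong) (auto simp: tensor_entry_id_diagram)
  then show "2 ^ loops d a (id_diagram d) * tensor_entry d (compose d a (id_diagram d)) f h
      = 2 ^ 0 * tensor_entry d a f h"
    using \<open>h \<subseteq> {..<d}\<close> by (simp add: sum_tensor_entry_mult id_diagram_in_brauer_diagrams a)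
qed (simp_all add: a compose_brauer_diagrams id_diagram_in_brauer_diagrams)

section \<open>Walled diagrams\<close>

text \<open>Orient strands downwards left of the wall and upwards right of it: the sign is \<open>1\<close> at sources and
  \<open>-1\<close> at targets.\<close>

definition wall_sign :: "nat \<Rightarrow> bool \<times> nat \<Rightarrow> int" where
  "wall_sign r p = (if fst p = (snd p < r) then 1 else - 1)"

lemma walled_iff_wall_sign:
  "m \<in> walled_brauer_diagrams r s \<longleftrightarrow>
    m \<in> brauer_diagrams (r + s) \<and> (\<forall>p\<in>pts (r + s). wall_sign r (m p) = - wall_sign r p)"
proof -
  have "(if fst (m p) = fst p then (snd (m p) < r) \<noteq> (snd p < r)
        else (snd (m p) < r) = (snd p < r)) \<longleftrightarrow> wall_sign r (m p) = - wall_sign r p" for p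
    by (auto simp: wall_sign_def)
  then show ?thesis by (simp add: walled_brauer_diagrams_def)
qed

definition stack_sign :: "nat \<Rightarrow> nat \<times> nat \<Rightarrow> int" where
  "stack_sign r v = (if (snd v < r) = (fst v = 1) then 1 else - 1)"

lemma stack_sign_level:
  "stack_sign r (level 0 p) = - wall_sign r p" "stack_sign r (level (Suc 0) p) = wall_sign r p"
  by (auto simp: stack_sign_def wall_sign_def level_def)

lemma stack_sign_lvl_out:
  "stack_sign r (lvl_out p) = (if fst p then - wall_sign r p else wall_sign r p)"
  by (auto simp: stack_sign_def wall_sign_def lvl_out_def)

lemma compose_walled_brauer_diagrams:
  assumes "a \<in> walled_brauer_diagrams r s" and "b \<in> walled_brauer_diagrams r s"
  shows "compose (r + s) a b \<in> walled_brauer_diagrams r s"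
proof -
  interpret stack "r + s" a b
    using assms unfolding walled_iff_wall_sign by (blast intro: stack.intro)
  have upper: "stack_sign r (upper v) = - stack_sign r v" if moved: "upper v \<noteq> v" for v
  proof -
    obtain p where "p \<in> pts (r + s)" "v = level 0 p" using strand_outside moved by blast
    then show ?thesis using assms(1) by (simp add: walled_iff_wall_sign strand_level stack_sign_level)
  qed
  have lower: "stack_sign r (lower v) = - stack_sign r v" if moved: "lower v \<noteq> v" for v
  proof -
    obtain p where "p \<in> pts (r + s)" "v = level (Suc 0) p" using strand_outside moved by blast
    then show ?thesis using assms(2) by (simp add: walled_iff_wall_sign strand_level stack_sign_level)
  qed
  show ?thesis
    unfolding walled_iff_wall_sign
  proof (intro conjI ballI compose_in_brauer_diagrams)
    fix p assume p: "p \<in> pts (r + s)"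
    define q where "q = compose (r + s) a b p"
    have q: "q \<in> pts (r + s)" "q \<noteq> p" "(lvl_out p, lvl_out q) \<in> conn"
      using compose_properties[OF p] by (simp_all add: q_def)
    have "upper (lvl_out t) = lvl_out t \<longleftrightarrow> \<not> fst t" if "t \<in> pts (r + s)" for t
      using that by (auto simp: upper_fixed_iff lvl_out_def pts_def)
    then have "stack_sign r (lvl_out q)
        = (if fst p \<longleftrightarrow> fst q then - stack_sign r (lvl_out p) else stack_sign r (lvl_out p))"
      using alternating_sign_at_endpoints[OF upper lower, of "lvl_out p" "lvl_out q"] p q
      by (simp add: endpoint_iff_outer outer_lvl_out_iff stack_conn_eq_dihedral_conn lvl_out_inject)
    then show "wall_sign r (compose (r + s) a b p) = - wall_sign r p"
      by (auto simp: q_def stack_sign_lvl_out split: if_splits)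
  qed
qed

lemma id_diagram_in_walled_brauer_diagrams: "id_diagram (r + s) \<in> walled_brauer_diagrams r s"
  using id_diagram_in_brauer_diagrams
  by (auto simp: walled_iff_wall_sign wall_sign_def id_diagram_def pts_def)

section \<open>Integers in a ring\<close>

context ring
begin

definition int_embed :: "int \<Rightarrow> 'a" where
  "int_embed k = add_pow R k \<one>"

lemma int_embed_closed [simp, intro]: "int_embed k \<in> carrier R"
  by (simp add: int_embed_def)

lemma int_embed_of_nat: "int_embed (int n) = add_pow R n \<one>"
  by (simp add: int_embed_def add_pow_int_ge)

lemma int_embed_0 [simp]: "int_embed 0 = \<zero>"
  by (simp add: int_embed_def add_pow_int_ge)

lemma int_embed_1 [simp]: "int_embed 1 = \<one>"
  by (simp add: int_embed_def add_pow_int_ge)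

lemma int_embed_add: "int_embed (i + j) = int_embed i \<oplus> int_embed j"
  unfolding int_embed_def by (rule add.int_pow_mult) simp

lemma int_embed_mult: "int_embed (i * j) = int_embed i \<otimes> int_embed j"
proof -
  have "int_embed i \<otimes> int_embed j = add_pow R i (\<one> \<otimes> int_embed j)"
    unfolding int_embed_def by (rule add_pow_ldistr_int) auto
  also have "\<dots> = int_embed (i * j)"
    unfolding int_embed_def using add.int_pow_pow[of \<one> i j] by (simp add: mult.commute)
  finally show ?thesis ..
qed

lemma int_embed_power: "int_embed (k ^ n) = int_embed k [^] n"
  by (induction n) (simp_all add: int_embed_mult power_Suc2 del: power_Suc)

lemma int_embed_sum: "int_embed (\<Sum>i\<in>B. f i) = (\<Oplus>i\<in>B. int_embed (f i))"
  by (induction B rule: infinite_finite_induct) (simp_all add: int_embed_add Pi_iff)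

end

definition char_exceeds :: "('a, 'm) ring_scheme \<Rightarrow> nat \<Rightarrow> bool" where
  "char_exceeds R N \<longleftrightarrow> (\<forall>n. 0 < n \<and> n \<le> N \<longrightarrow> add_pow R n \<one>\<^bsub>R\<^esub> \<noteq> \<zero>\<^bsub>R\<^esub>)"

lemma (in ring) int_embed_eq_zero_iff:
  assumes "char_exceeds R N" "nat \<bar>k\<bar> \<le> N"
  shows "int_embed k = \<zero> \<longleftrightarrow> k = 0"
proof
  assume "int_embed k = \<zero>"
  then have "int_embed (k * sgn k) = \<zero>" by (simp add: int_embed_mult)
  moreover have "k * sgn k = int (nat \<bar>k\<bar>)" using abs_sgn[of k] by simp
  ultimately have "add_pow R (nat \<bar>k\<bar>) \<one> = \<zero>" by (simp only: int_embed_of_nat)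
  moreover have "add_pow R (nat \<bar>k\<bar>) \<one> \<noteq> \<zero>" if "k \<noteq> 0"
    using assms that by (simp add: char_exceeds_def)
  ultimately show "k = 0" by blast
qed simp

lemma (in residues) add_pow_one: "add_pow R (n :: nat) \<one> = int n mod m"
proof (induction n)
  case 0
  show ?case by (simp add: res_zero_eq)
next
  case (Suc n)
  then show ?case by (simp add: res_add_eq res_one_eq mod_add_right_eq add.commute)
qed

lemma char_exceeds_residue_ring:
  assumes "1 < p" "N < p"
  shows "char_exceeds (residue_ring (int p)) N"
proof -
  interpret residues "int p" "residue_ring (int p)"
    using assms by unfold_locales auto
  show ?thesis using assms by (auto simp: char_exceeds_def add_pow_one res_zero_eq)
qed

section \<open>Coordinate spaces\<close>

locale coordinate_module = cring R
  for R :: "('a, 'm) ring_scheme" (structure) and D :: "'b set" and V :: "('b \<Rightarrow> 'a, 'n) ring_scheme" +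
  assumes finite_D: "finite D"
    and carrier_V: "carrier V = {f. (\<forall>c\<in>D. f c \<in> carrier R) \<and> (\<forall>c. c \<notin> D \<longrightarrow> f c = \<zero>)}"
    and zero_V: "\<zero>\<^bsub>V\<^esub> = (\<lambda>c. \<zero>)"
    and add_V: "x \<oplus>\<^bsub>V\<^esub> y = (\<lambda>c. if c \<in> D then x c \<oplus> y c else \<zero>)"
begin

lemma vecI: "(\<And>c. c \<in> D \<Longrightarrow> x c \<in> carrier R) \<Longrightarrow> (\<And>c. c \<notin> D \<Longrightarrow> x c = \<zero>) \<Longrightarrow> x \<in> carrier V"
  unfolding carrier_V by blast

lemma coord_outside: "x \<in> carrier V \<Longrightarrow> c \<notin> D \<Longrightarrow> x c = \<zero>"
  unfolding carrier_V by blast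

lemma coord_closed [simp, intro]: "x \<in> carrier V \<Longrightarrow> x c \<in> carrier R"
  unfolding carrier_V by (cases "c \<in> D") auto

lemma vec_eqI:
  assumes "x \<in> carrier V" "y \<in> carrier V" "\<And>c. c \<in> D \<Longrightarrow> x c = y c"
  shows "x = y"
proof
  show "x c = y c" for c
    using assms(3) coord_outside[OF assms(1)] coord_outside[OF assms(2)] by (cases "c \<in> D") auto
qed

lemma zero_coord [simp]: "\<zero>\<^bsub>V\<^esub> c = \<zero>"
  by (simp add: zero_V)

lemma add_coord [simp]: "x \<in> carrier V \<Longrightarrow> y \<in> carrier V \<Longrightarrow> (x \<oplus>\<^bsub>V\<^esub> y) c = x c \<oplus> y c"
  by (simp add: add_V coord_outside)

lemma abelian_group_V: "abelian_group V"
proof (rule abelian_groupI)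
  show "x \<oplus>\<^bsub>V\<^esub> y \<in> carrier V" if "x \<in> carrier V" "y \<in> carrier V" for x y
    by (rule vecI) (use that in \<open>auto simp: add_V\<close>)
  show "\<zero>\<^bsub>V\<^esub> \<in> carrier V" by (rule vecI) auto
  show "\<exists>y\<in>carrier V. y \<oplus>\<^bsub>V\<^esub> x = \<zero>\<^bsub>V\<^esub>" if x: "x \<in> carrier V" for x
  proof
    show "(\<lambda>c. \<ominus> x c) \<in> carrier V" by (rule vecI) (use x in \<open>auto simp: coord_outside\<close>)
    then show "(\<lambda>c. \<ominus> x c) \<oplus>\<^bsub>V\<^esub> x = \<zero>\<^bsub>V\<^esub>" using x by (simp add: fun_eq_iff l_neg)
  qed
qed (auto simp: add_V fun_eq_iff coord_outside a_ac)

end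

sublocale coordinate_module \<subseteq> vec: abelian_group V
  by (rule abelian_group_V)

context coordinate_module
begin

lemma finsum_coord: "F \<in> B \<rightarrow> carrier V \<Longrightarrow> (finsum V F B) c = (\<Oplus>i\<in>B. F i c)"
proof (induction B rule: infinite_finite_induct)
  case (insert i B)
  then have "(\<lambda>i. F i c) \<in> B \<rightarrow> carrier R" by blast
  then show ?case using insert by (simp add: Pi_iff)
qed auto

definition scale :: "'a \<Rightarrow> ('b \<Rightarrow> 'a) \<Rightarrow> 'b \<Rightarrow> 'a" (infixr "\<star>" 75) where
  "r \<star> x = (\<lambda>c. r \<otimes> x c)"

definition basis :: "'b \<Rightarrow> 'b \<Rightarrow> 'a" where
  "basis b = (\<lambda>c. if b = c then \<one> else \<zero>)"

lemma scale_coord [simp]: "(r \<star> x) c = r \<otimes> x c"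
  by (simp add: scale_def)

lemma scale_closed [simp, intro]: "r \<in> carrier R \<Longrightarrow> x \<in> carrier V \<Longrightarrow> r \<star> x \<in> carrier V"
  by (rule vecI) (auto simp: coord_outside)

lemma basis_closed [simp, intro]: "b \<in> D \<Longrightarrow> basis b \<in> carrier V"
  by (rule vecI) (auto simp: basis_def)

lemma basis_expansion:
  assumes x: "x \<in> carrier V"
  shows "x = (\<Oplus>\<^bsub>V\<^esub>b\<in>D. x b \<star> basis b)"
proof (rule vec_eqI)
  have F: "(\<lambda>b. x b \<star> basis b) \<in> D \<rightarrow> carrier V" using x by auto
  then show "(\<Oplus>\<^bsub>V\<^esub>b\<in>D. x b \<star> basis b) \<in> carrier V" by (rule vec.finsum_closed)
  fix c assume c: "c \<in> D"
  have "(\<Oplus>\<^bsub>V\<^esub>b\<in>D. x b \<star> basis b) c = (\<Oplus>b\<in>D. if c = b then x b else \<zero>)"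
    unfolding finsum_coord[OF F] using x by (intro finsum_cong') (auto simp: basis_def)
  also have "\<dots> = x c" using c finite_D x by (intro finsum_singleton) auto
  finally show "x c = (\<Oplus>\<^bsub>V\<^esub>b\<in>D. x b \<star> basis b) c" ..
qed (rule x)

definition linear_functional :: "(('b \<Rightarrow> 'a) \<Rightarrow> 'a) \<Rightarrow> bool" where
  "linear_functional \<phi> \<longleftrightarrow> \<phi> \<in> carrier V \<rightarrow> carrier R
    \<and> (\<forall>x\<in>carrier V. \<forall>y\<in>carrier V. \<phi> (x \<oplus>\<^bsub>V\<^esub> y) = \<phi> x \<oplus> \<phi> y)
    \<and> (\<forall>r\<in>carrier R. \<forall>x\<in>carrier V. \<phi> (r \<star> x) = r \<otimes> \<phi> x)"

definition linear_operator :: "(('b \<Rightarrow> 'a) \<Rightarrow> 'b \<Rightarrow> 'a) \<Rightarrow> bool" where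
  "linear_operator F \<longleftrightarrow> F \<in> carrier V \<rightarrow> carrier V
    \<and> (\<forall>x\<in>carrier V. \<forall>y\<in>carrier V. F (x \<oplus>\<^bsub>V\<^esub> y) = F x \<oplus>\<^bsub>V\<^esub> F y)
    \<and> (\<forall>r\<in>carrier R. \<forall>x\<in>carrier V. F (r \<star> x) = r \<star> F x)"

lemma linear_functional_closed: "linear_functional \<phi> \<Longrightarrow> x \<in> carrier V \<Longrightarrow> \<phi> x \<in> carrier R"
  unfolding linear_functional_def by blast

lemma linear_operator_closed: "linear_operator F \<Longrightarrow> x \<in> carrier V \<Longrightarrow> F x \<in> carrier V"
  unfolding linear_operator_def by blast

lemma linear_operator_comp: "linear_operator F \<Longrightarrow> linear_operator G \<Longrightarrow> linear_operator (\<lambda>x. F (G x))"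
  unfolding linear_operator_def by (simp add: Pi_iff)

lemma linear_functional_comp: "linear_functional \<phi> \<Longrightarrow> linear_operator F \<Longrightarrow> linear_functional (\<lambda>x. \<phi> (F x))"
  unfolding linear_functional_def linear_operator_def by (simp add: Pi_iff)

lemma linear_functional_coord: "linear_functional (\<lambda>x. x c)"
  by (auto simp: linear_functional_def)

lemma linear_functional_cong:
  "(\<And>x. x \<in> carrier V \<Longrightarrow> \<phi> x = \<psi> x) \<Longrightarrow> linear_functional \<phi> \<longleftrightarrow> linear_functional \<psi>"
  unfolding linear_functional_def by (simp add: Pi_iff del: add_coord)

lemma linear_operatorI:
  assumes closed: "\<And>x. x \<in> carrier V \<Longrightarrow> F x \<in> carrier V"
    and coord: "\<And>c. c \<in> D \<Longrightarrow> linear_functional (\<lambda>x. F x c)"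
  shows "linear_operator F"
  unfolding linear_operator_def
proof (intro conjI ballI funcsetI)
  show "F x \<in> carrier V" if "x \<in> carrier V" for x using that by (rule closed)
  show "F (x \<oplus>\<^bsub>V\<^esub> y) = F x \<oplus>\<^bsub>V\<^esub> F y" if "x \<in> carrier V" "y \<in> carrier V" for x y
    using coord closed that by (intro vec_eqI) (simp_all add: linear_functional_def del: add_coord, simp)
  show "F (r \<star> x) = r \<star> F x" if "r \<in> carrier R" "x \<in> carrier V" for r x
    using coord closed that by (intro vec_eqI) (simp_all add: linear_functional_def)
qed

lemma linear_functional_zero: "linear_functional \<phi> \<Longrightarrow> \<phi> \<zero>\<^bsub>V\<^esub> = \<zero>"
  unfolding linear_functional_def by (metis vec.l_zero vec.zero_closed PiE add.l_cancel_one')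

lemma linear_functional_finsum:
  assumes \<phi>: "linear_functional \<phi>" and F: "F \<in> B \<rightarrow> carrier V"
  shows "\<phi> (finsum V F B) = (\<Oplus>i\<in>B. \<phi> (F i))"
  using F
proof (induction B rule: infinite_finite_induct)
  case (insert i B)
  then have "\<phi> (F i \<oplus>\<^bsub>V\<^esub> finsum V F B) = \<phi> (F i) \<oplus> \<phi> (finsum V F B)"
    using \<phi> by (simp add: linear_functional_def Pi_iff)
  moreover have "(\<lambda>i. \<phi> (F i)) \<in> insert i B \<rightarrow> carrier R"
    using insert.prems linear_functional_closed[OF \<phi>] by blast
  ultimately show ?case using insert by (simp add: Pi_iff del: add_coord)
qed (simp_all add: linear_functional_zero[OF \<phi>])

lemma linear_functional_expansion:
  assumes \<phi>: "linear_functional \<phi>" and x: "x \<in> carrier V"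
  shows "\<phi> x = (\<Oplus>b\<in>D. x b \<otimes> \<phi> (basis b))"
proof -
  have "\<phi> x = (\<Oplus>b\<in>D. \<phi> (x b \<star> basis b))"
    using x by (subst basis_expansion[OF x]) (auto intro: linear_functional_finsum[OF \<phi>])
  also have "\<dots> = (\<Oplus>b\<in>D. x b \<otimes> \<phi> (basis b))"
    using x \<phi> by (intro finsum_cong') (auto simp: linear_functional_def)
  finally show ?thesis .
qed

lemma linear_operator_finsum:
  assumes F: "linear_operator F" and G: "G \<in> B \<rightarrow> carrier V"
  shows "F (finsum V G B) = (\<Oplus>\<^bsub>V\<^esub>i\<in>B. F (G i))"
proof
  have "(\<lambda>i. F (G i)) \<in> B \<rightarrow> carrier V" using G linear_operator_closed[OF F] by blast
  then show "F (finsum V G B) c = (\<Oplus>\<^bsub>V\<^esub>i\<in>B. F (G i)) c" for c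
    using linear_functional_finsum[OF linear_functional_comp[OF linear_functional_coord F] G]
    by (simp add: finsum_coord)
qed

lemma linear_operator_finsum_scale:
  assumes F: "linear_operator F" and "k \<in> B \<rightarrow> carrier R" "x \<in> B \<rightarrow> carrier V"
  shows "F (\<Oplus>\<^bsub>V\<^esub>i\<in>B. k i \<star> x i) = (\<Oplus>\<^bsub>V\<^esub>i\<in>B. k i \<star> F (x i))"
proof -
  have closed: "k i \<in> carrier R" "x i \<in> carrier V" if "i \<in> B" for i using assms that by auto
  then have "F (\<Oplus>\<^bsub>V\<^esub>i\<in>B. k i \<star> x i) = (\<Oplus>\<^bsub>V\<^esub>i\<in>B. F (k i \<star> x i))"
    by (intro linear_operator_finsum[OF F]) auto
  also have "\<dots> = (\<Oplus>\<^bsub>V\<^esub>i\<in>B. k i \<star> F (x i))"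
    using F closed linear_operator_closed[OF F] by (intro vec.finsum_cong') (auto simp: linear_operator_def)
  finally show ?thesis .
qed

lemma linear_functional_mult_right:
  "linear_functional \<phi> \<Longrightarrow> k \<in> carrier R \<Longrightarrow> linear_functional (\<lambda>x. \<phi> x \<otimes> k)"
  unfolding linear_functional_def by (simp add: Pi_iff l_distr m_assoc)

lemma linear_functional_sum:
  assumes "finite B" and "\<And>i. i \<in> B \<Longrightarrow> linear_functional (\<phi> i)"
  shows "linear_functional (\<lambda>x. \<Oplus>i\<in>B. \<phi> i x)"
  unfolding linear_functional_def
proof (intro conjI ballI funcsetI)
  have closed: "(\<lambda>i. \<phi> i x) \<in> B \<rightarrow> carrier R" if "x \<in> carrier V" for x
    using that assms(2) linear_functional_closed by blast
  then show "(\<Oplus>i\<in>B. \<phi> i x) \<in> carrier R" if "x \<in> carrier V" for x using that by (intro finsum_closed)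
  fix x assume x: "x \<in> carrier V"
  show "(\<Oplus>i\<in>B. \<phi> i (x \<oplus>\<^bsub>V\<^esub> y)) = (\<Oplus>i\<in>B. \<phi> i x) \<oplus> (\<Oplus>i\<in>B. \<phi> i y)" if y: "y \<in> carrier V" for y
  proof -
    have "(\<Oplus>i\<in>B. \<phi> i (x \<oplus>\<^bsub>V\<^esub> y)) = (\<Oplus>i\<in>B. \<phi> i x \<oplus> \<phi> i y)"
      using assms closed x y by (intro finsum_cong') (auto simp: linear_functional_def Pi_iff)
    also have "\<dots> = (\<Oplus>i\<in>B. \<phi> i x) \<oplus> (\<Oplus>i\<in>B. \<phi> i y)"
      using closed x y by (intro finsum_addf)
    finally show ?thesis .
  qed
  show "(\<Oplus>i\<in>B. \<phi> i (r \<star> x)) = r \<otimes> (\<Oplus>i\<in>B. \<phi> i x)" if r: "r \<in> carrier R" for r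
  proof -
    have "(\<Oplus>i\<in>B. \<phi> i (r \<star> x)) = (\<Oplus>i\<in>B. r \<otimes> \<phi> i x)"
      using assms closed[OF x] x r by (intro finsum_cong') (auto simp: linear_functional_def Pi_iff)
    also have "\<dots> = r \<otimes> (\<Oplus>i\<in>B. \<phi> i x)"
      using \<open>finite B\<close> r closed[OF x] by (intro finsum_rdistr[symmetric])
    finally show ?thesis .
  qed
qed

lemma linear_operator_expansion:
  assumes F: "linear_operator F" and x: "x \<in> carrier V"
  shows "F x = (\<Oplus>\<^bsub>V\<^esub>b\<in>D. x b \<star> F (basis b))"
  by (subst basis_expansion[OF x], rule linear_operator_finsum_scale[OF F]) (use x in auto)

lemma linear_operator_eq_on_basis:
  assumes F: "linear_operator F" and G: "linear_operator G"
    and eq: "\<And>b. b \<in> D \<Longrightarrow> F (basis b) = G (basis b)" and x: "x \<in> carrier V"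
  shows "F x = G x"
  unfolding linear_operator_expansion[OF F x] linear_operator_expansion[OF G x]
  using eq x linear_operator_closed[OF G] by (intro vec.finsum_cong') auto

definition trace :: "(('b \<Rightarrow> 'a) \<Rightarrow> 'b \<Rightarrow> 'a) \<Rightarrow> 'a" where
  "trace F = (\<Oplus>b\<in>D. F (basis b) b)"

lemma trace_cong: "linear_operator G \<Longrightarrow> (\<And>x. x \<in> carrier V \<Longrightarrow> F x = G x) \<Longrightarrow> trace F = trace G"
  unfolding trace_def using linear_operator_closed by (intro finsum_cong') auto

lemma trace_comp_commute:
  assumes F: "linear_operator F" and G: "linear_operator G"
  shows "trace (\<lambda>x. F (G x)) = trace (\<lambda>x. G (F x))"
proof -
  have closed: "F (basis b) c \<in> carrier R" "G (basis b) c \<in> carrier R" if "b \<in> D" for b c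
    using that F G linear_operator_closed by auto
  have expand: "trace (\<lambda>x. F (G x)) = (\<Oplus>b\<in>D. \<Oplus>c\<in>D. G (basis b) c \<otimes> F (basis c) b)"
    if "linear_operator F" "linear_operator G" for F G
    unfolding trace_def using that linear_operator_closed
    by (intro finsum_cong' linear_functional_expansion linear_functional_comp[OF linear_functional_coord])
      auto
  show ?thesis
    unfolding expand[OF F G] expand[OF G F]
    using closed finite_D by (subst finsum_finsum_swap) (auto intro!: finsum_cong' simp: m_comm)
qed

end


locale coordinate_space = coordinate_module R D V + field R
  for R :: "('a, 'm) ring_scheme" (structure) and D :: "'b set" and V :: "('b \<Rightarrow> 'a, 'n) ring_scheme"
begin

definition subspace :: "('b \<Rightarrow> 'a) set \<Rightarrow> bool" where
  "subspace W \<longleftrightarrow> W \<subseteq> carrier V \<and> \<zero>\<^bsub>V\<^esub> \<in> W \<and> (\<forall>x\<in>W. \<forall>y\<in>W. x \<oplus>\<^bsub>V\<^esub> y \<in> W)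
    \<and> (\<forall>r\<in>carrier R. \<forall>x\<in>W. r \<star> x \<in> W)"

lemma subspace_finsum:
  assumes W: "subspace W" and F: "F \<in> B \<rightarrow> W"
  shows "finsum V F B \<in> W"
  using F
proof (induction B rule: infinite_finite_induct)
  case (insert i B)
  then have "F i \<in> carrier V" "F \<in> B \<rightarrow> carrier V" using W unfolding subspace_def by blast+
  then have "finsum V F (insert i B) = F i \<oplus>\<^bsub>V\<^esub> finsum V F B" using insert.hyps by simp
  then show ?case using insert W by (simp add: subspace_def Pi_iff del: add_coord)
qed (use W in \<open>simp_all add: subspace_def\<close>)

lemma subspace_image:
  assumes F: "linear_operator F"
  shows "subspace (F ` carrier V)"
proof -
  have "F x \<oplus>\<^bsub>V\<^esub> F y \<in> F ` carrier V" if "x \<in> carrier V" "y \<in> carrier V" for x y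
    using that F unfolding linear_operator_def by (metis imageI vec.a_closed)
  moreover have "r \<star> F x \<in> F ` carrier V" if "r \<in> carrier R" "x \<in> carrier V" for r x
    using that F unfolding linear_operator_def by (metis imageI scale_closed)
  moreover have "\<zero>\<^bsub>V\<^esub> = F \<zero>\<^bsub>V\<^esub>"
    using linear_operator_finsum[OF F, of undefined "{}"] by simp
  ultimately show ?thesis
    unfolding subspace_def using linear_operator_closed[OF F] by auto
qed

definition determined_by :: "('b \<Rightarrow> 'a) set \<Rightarrow> 'b set \<Rightarrow> bool" where
  "determined_by W C \<longleftrightarrow> C \<subseteq> D \<and> (\<forall>x\<in>W. (\<forall>c\<in>C. x c = \<zero>) \<longrightarrow> x = \<zero>\<^bsub>V\<^esub>)"

definition echelon_basis :: "('b \<Rightarrow> 'a) set \<Rightarrow> 'b set \<Rightarrow> ('b \<Rightarrow> 'b \<Rightarrow> 'a) \<Rightarrow> bool" where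
  "echelon_basis W C w \<longleftrightarrow> determined_by W C \<and> w \<in> C \<rightarrow> W
    \<and> (\<forall>c\<in>C. \<forall>c'\<in>C. w c c' = (if c = c' then \<one> else \<zero>))"

text \<open>The pivot columns form a minimal set of coordinates that determine the elements of the subspace.\<close>

lemma exists_echelon_basis:
  assumes W: "subspace W"
  shows "\<exists>C w. echelon_basis W C w"
proof -
  have W_carrier: "W \<subseteq> carrier V" using W by (simp add: subspace_def)
  then have "determined_by W D" by (auto simp: determined_by_def intro: vec_eqI)
  moreover have "finite {C. determined_by W C}"
    by (rule finite_subset[of _ "Pow D"]) (auto simp: determined_by_def finite_D)
  ultimately obtain C where C: "determined_by W C"
    and minimal: "\<And>C'. determined_by W C' \<Longrightarrow> C' \<subseteq> C \<Longrightarrow> C = C'"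
    using finite_has_minimal[of "{C. determined_by W C}"] by blast
  have "\<exists>x\<in>W. \<forall>c'\<in>C. x c' = (if c = c' then \<one> else \<zero>)" if c: "c \<in> C" for c
  proof -
    have "\<not> determined_by W (C - {c})" using minimal[of "C - {c}"] c by blast
    then obtain x where x: "x \<in> W" "x \<noteq> \<zero>\<^bsub>V\<^esub>" "\<And>c'. c' \<in> C - {c} \<Longrightarrow> x c' = \<zero>"
      using C unfolding determined_by_def by blast
    then have "x c \<noteq> \<zero>" using C unfolding determined_by_def by blast
    then have unit: "x c \<in> Units R" using x(1) W_carrier by (auto simp: field_Units)
    have "inv (x c) \<star> x \<in> W" using W x(1) unit by (simp add: subspace_def)
    moreover have "(inv (x c) \<star> x) c' = (if c = c' then \<one> else \<zero>)" if "c' \<in> C" for c'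
      using that x(3) unit by auto
    ultimately show ?thesis by blast
  qed
  then have "\<exists>w. \<forall>c\<in>C. w c \<in> W \<and> (\<forall>c'\<in>C. w c c' = (if c = c' then \<one> else \<zero>))" by metis
  then show ?thesis using C unfolding echelon_basis_def by blast
qed

definition combination :: "'b set \<Rightarrow> ('b \<Rightarrow> 'b \<Rightarrow> 'a) \<Rightarrow> ('b \<Rightarrow> 'a) \<Rightarrow> 'b \<Rightarrow> 'a" where
  "combination C w x = (\<Oplus>\<^bsub>V\<^esub>c\<in>C. x c \<star> w c)"

lemma combination_coord:
  "w \<in> C \<rightarrow> carrier V \<Longrightarrow> x \<in> carrier V \<Longrightarrow> combination C w x b = (\<Oplus>c\<in>C. x c \<otimes> w c b)"
  unfolding combination_def by (subst finsum_coord) auto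

lemma linear_operator_combination:
  assumes C: "C \<subseteq> D" and w: "w \<in> C \<rightarrow> carrier V"
  shows "linear_operator (combination C w)"
proof (rule linear_operatorI)
  show "combination C w x \<in> carrier V" if "x \<in> carrier V" for x
    unfolding combination_def using that w by (intro vec.finsum_closed) auto
  fix b
  have "linear_functional (\<lambda>x. \<Oplus>c\<in>C. x c \<otimes> w c b)"
    using finite_subset[OF C finite_D] w
    by (intro linear_functional_sum linear_functional_mult_right linear_functional_coord) auto
  then show "linear_functional (\<lambda>x. combination C w x b)"
    using linear_functional_cong[of "\<lambda>x. combination C w x b"] combination_coord[OF w] by simp
qed

lemma echelon_basis_closed:
  assumes "subspace W" "echelon_basis W C w"
  shows "C \<subseteq> D" "w \<in> C \<rightarrow> W" "w \<in> C \<rightarrow> carrier V"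
  using assms unfolding subspace_def echelon_basis_def determined_by_def by blast+

lemma combination_in_subspace:
  assumes W: "subspace W" and w: "w \<in> C \<rightarrow> W" and x: "x \<in> carrier V"
  shows "combination C w x \<in> W"
  unfolding combination_def
proof (rule subspace_finsum[OF W], rule funcsetI)
  fix c assume "c \<in> C"
  then show "x c \<star> w c \<in> W" using W w coord_closed[OF x] unfolding subspace_def by blast
qed

lemma combination_echelon_basis_eq:
  assumes W: "subspace W" and echelon: "echelon_basis W C w" and x: "x \<in> W"
  shows "combination C w x = x"
proof -
  have W_carrier: "W \<subseteq> carrier V" using W by (simp add: subspace_def)
  note w = echelon_basis_closed(2,3)[OF W echelon]
  have "finite C" using echelon_basis_closed(1)[OF W echelon] finite_D by (rule finite_subset)
  define y where "y = combination C w x \<oplus>\<^bsub>V\<^esub> (\<ominus> \<one>) \<star> x"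
  have x_carrier: "x \<in> carrier V" using x W_carrier by blast
  have combination_in_W: "combination C w x \<in> W" using W w(1) x_carrier by (rule combination_in_subspace)
  then have y_in_W: "y \<in> W" using W x by (simp add: y_def subspace_def)
  have y: "y c = combination C w x c \<ominus> x c" for c
    using combination_in_W W_carrier x_carrier by (auto simp: y_def minus_eq l_minus)
  have "y c = \<zero>" if c: "c \<in> C" for c
  proof -
    have "combination C w x c = (\<Oplus>c'\<in>C. if c = c' then x c' else \<zero>)"
      unfolding combination_coord[OF w(2) x_carrier] using c x_carrier echelon
      by (intro finsum_cong') (auto simp: echelon_basis_def)
    then have "combination C w x c = x c" using c x_carrier \<open>finite C\<close> by (simp add: finsum_singleton)
    then show ?thesis using y x_carrier by (simp add: minus_eq r_neg)
  qed
  then have "y = \<zero>\<^bsub>V\<^esub>" using echelon y_in_W by (simp add: echelon_basis_def determined_by_def)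
  then have "combination C w x c \<ominus> x c = \<zero>" for c using y by (metis zero_coord)
  then have "combination C w x c = x c" for c
    using combination_in_W W_carrier x_carrier by (auto simp: r_right_minus_eq)
  then show ?thesis by (rule ext)
qed

lemma trace_combination_echelon_basis:
  assumes "subspace W" "echelon_basis W C w"
  shows "trace (combination C w) = int_embed (int (card C))"
proof -
  note C = echelon_basis_closed(1)[OF assms] and w = echelon_basis_closed(3)[OF assms]
  have "finite C" using C finite_D by (rule finite_subset)
  have "trace (combination C w) = (\<Oplus>b\<in>D. \<Oplus>c\<in>C. basis b c \<otimes> w c b)"
    unfolding trace_def using w C by (intro finsum_cong') (auto simp: combination_coord Pi_iff)
  also have "\<dots> = (\<Oplus>c\<in>C. \<Oplus>b\<in>D. basis b c \<otimes> w c b)"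
    using w finite_D \<open>finite C\<close> by (intro finsum_finsum_swap) (auto simp: Pi_iff)
  also have "\<dots> = (\<Oplus>c\<in>C. \<one>)"
  proof (rule finsum_cong')
    fix c assume c: "c \<in> C"
    then have w_carrier: "w c \<in> carrier V" using w by blast
    have "(\<Oplus>b\<in>D. basis b c \<otimes> w c b) = (\<Oplus>b\<in>D. if c = b then w c b else \<zero>)"
      using w_carrier by (intro finsum_cong') (auto simp: basis_def)
    also have "\<dots> = w c c" using c C finite_D w_carrier by (intro finsum_singleton) auto
    finally show "(\<Oplus>b\<in>D. basis b c \<otimes> w c b) = \<one>" using assms(2) c by (simp add: echelon_basis_def)
  qed auto
  also have "\<dots> = int_embed (int (card C))"
    by (simp add: int_embed_of_nat add.finprod_const)
  finally show ?thesis .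
qed

definition projection_onto :: "('b \<Rightarrow> 'a) set \<Rightarrow> (('b \<Rightarrow> 'a) \<Rightarrow> 'b \<Rightarrow> 'a) \<Rightarrow> bool" where
  "projection_onto W P \<longleftrightarrow> linear_operator P \<and> P \<in> carrier V \<rightarrow> W \<and> (\<forall>x\<in>W. P x = x)"

lemma exists_projection:
  assumes W: "subspace W"
  shows "\<exists>P n. projection_onto W P \<and> trace P = int_embed (int n) \<and> n \<le> card D \<and> (n = 0 \<longrightarrow> W = {\<zero>\<^bsub>V\<^esub>})"
proof -
  obtain C w where echelon: "echelon_basis W C w" using exists_echelon_basis[OF W] by blast
  note C = echelon_basis_closed(1)[OF W echelon] and w = echelon_basis_closed(2,3)[OF W echelon]
  show ?thesis
  proof (intro exI conjI impI)
    show "projection_onto W (combination C w)"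
      unfolding projection_onto_def
      using linear_operator_combination[OF C w(2)] combination_in_subspace[OF W w(1)]
        combination_echelon_basis_eq[OF W echelon] by blast
    show "trace (combination C w) = int_embed (int (card C))"
      using W echelon by (rule trace_combination_echelon_basis)
    show "card C \<le> card D" using finite_D C by (rule card_mono)
    assume "card C = 0"
    then have "C = {}" using finite_subset[OF C finite_D] by simp
    then show "W = {\<zero>\<^bsub>V\<^esub>}"
      using W echelon unfolding subspace_def echelon_basis_def determined_by_def by blast
  qed
qed

lemma trace_idempotent:
  assumes F: "linear_operator F" and idem: "\<And>x. x \<in> carrier V \<Longrightarrow> F (F x) = F x"
  shows "\<exists>n\<le>card D. trace F = int_embed (int n) \<and> (n = 0 \<longrightarrow> F ` carrier V = {\<zero>\<^bsub>V\<^esub>})"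
proof -
  obtain P n where P: "projection_onto (F ` carrier V) P"
    and n: "trace P = int_embed (int n)" "n \<le> card D" "n = 0 \<longrightarrow> F ` carrier V = {\<zero>\<^bsub>V\<^esub>}"
    using exists_projection[OF subspace_image[OF F]] by blast
  then have linear: "linear_operator P" by (simp add: projection_onto_def)
  have "trace F = trace (\<lambda>x. P (F x))"
    using P linear_operator_comp[OF linear F] by (intro trace_cong) (auto simp: projection_onto_def)
  also have "\<dots> = trace (\<lambda>x. F (P x))" by (rule trace_comp_commute[OF linear F])
  also have "\<dots> = trace P"
  proof (rule trace_cong[OF linear])
    fix x assume "x \<in> carrier V"
    then obtain y where "y \<in> carrier V" "P x = F y" using P unfolding projection_onto_def by blast
    then show "F (P x) = P x" using idem by simp
  qed
  finally show ?thesis using n by auto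
qed

end

section \<open>Semisimplicity and the trace form\<close>

lemma (in ring) left_idealI:
  assumes "I \<subseteq> carrier R" "\<zero> \<in> I" "\<And>x y. x \<in> I \<Longrightarrow> y \<in> I \<Longrightarrow> x \<oplus> y \<in> I"
    and "\<And>a x. a \<in> carrier R \<Longrightarrow> x \<in> I \<Longrightarrow> a \<otimes> x \<in> I"
  shows "left_ideal I R"
proof -
  have "\<ominus> x \<in> I" if "x \<in> I" for x
  proof -
    have "\<ominus> x = (\<ominus> \<one>) \<otimes> x" using that assms(1) by (auto simp: l_minus)
    then show ?thesis using assms(4)[of "\<ominus> \<one>" x] that by simp
  qed
  then show ?thesis using assms by (auto simp: left_ideal_def)
qed

lemma (in ring) left_ideal_right_unit_imp_semisimple:
  assumes "\<And>I. left_ideal I R \<Longrightarrow> \<exists>e\<in>I. \<forall>y\<in>I. y \<otimes> e = y"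
  shows "semisimple R"
  unfolding semisimple_def
proof (intro allI impI)
  fix I assume I: "left_ideal I R"
  then obtain e where e: "e \<in> I" "\<And>y. y \<in> I \<Longrightarrow> y \<otimes> e = y" using assms by blast
  then have e_carrier: "e \<in> carrier R" using I by (auto simp: left_ideal_def)
  define J where "J = {x \<in> carrier R. x \<otimes> e = \<zero>}"
  have "left_ideal J R"
    by (rule left_idealI) (use e_carrier in \<open>auto simp: J_def l_distr m_assoc\<close>)
  moreover have "I \<inter> J = {\<zero>}"
    using e I e_carrier by (auto simp: J_def left_ideal_def)
  moreover have "\<exists>i\<in>I. \<exists>j\<in>J. x = i \<oplus> j" if x: "x \<in> carrier R" for x
  proof (intro bexI)
    show "x = x \<otimes> e \<oplus> (x \<ominus> x \<otimes> e)"
      using x e_carrier by (simp add: minus_eq a_lcomm r_neg)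
    show "x \<otimes> e \<in> I" using I x e by (simp add: left_ideal_def)
    show "x \<ominus> x \<otimes> e \<in> J"
      using x e_carrier e by (simp add: J_def minus_eq l_distr l_minus m_assoc r_neg)
  qed
  ultimately show "\<exists>J. left_ideal J R \<and> I \<inter> J = {\<zero>} \<and> (\<forall>x\<in>carrier R. \<exists>i\<in>I. \<exists>j\<in>J. x = i \<oplus> j)"
    by blast
qed

lemma (in ring) semisimple_imp_left_ideal_right_unit:
  assumes "semisimple R" "left_ideal I R"
  shows "\<exists>e\<in>I. \<forall>y\<in>I. y \<otimes> e = y"
proof -
  obtain J where J: "left_ideal J R" "I \<inter> J = {\<zero>}" "\<forall>x\<in>carrier R. \<exists>i\<in>I. \<exists>j\<in>J. x = i \<oplus> j"
    using assms(1)[unfolded semisimple_def, rule_format, OF assms(2)] by (elim exE conjE)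
  obtain e f where ef: "e \<in> I" "f \<in> J" "\<one> = e \<oplus> f" using J(3) one_closed by blast
  have subsets: "I \<subseteq> carrier R" "J \<subseteq> carrier R" using assms(2) J(1) by (auto simp: left_ideal_def)
  have ef_carrier: "e \<in> carrier R" "f \<in> carrier R" using ef subsets by auto
  have "y \<otimes> e = y" if y: "y \<in> I" for y
  proof -
    have y_carrier: "y \<in> carrier R" using y subsets by blast
    have y_eq: "y = y \<otimes> e \<oplus> y \<otimes> f" using ef y_carrier ef_carrier by (metis r_distr r_one)
    have "y \<otimes> e \<in> I" "y \<otimes> f \<in> J" using ef assms(2) J(1) y_carrier by (auto simp: left_ideal_def)
    moreover have "y \<otimes> f = \<ominus> (y \<otimes> e) \<oplus> y"
      using y_eq y_carrier ef_carrier by (metis m_closed r_neg1)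
    ultimately have "y \<otimes> f \<in> I" using assms(2) y by (auto simp: left_ideal_def)
    then have "y \<otimes> f = \<zero>" using \<open>y \<otimes> f \<in> J\<close> J(2) by blast
    then show ?thesis using y_eq y_carrier ef_carrier by simp
  qed
  then show ?thesis using ef by blast
qed

locale coordinate_algebra = coordinate_module R D A + alg: ring A
  for R :: "('a, 'm) ring_scheme" (structure) and D :: "'b set" and A :: "('b \<Rightarrow> 'a, 'n) ring_scheme" +
  assumes scale_mult: "\<lbrakk>r \<in> carrier R; x \<in> carrier A; y \<in> carrier A\<rbrakk> \<Longrightarrow> (r \<star> x) \<otimes>\<^bsub>A\<^esub> y = r \<star> (x \<otimes>\<^bsub>A\<^esub> y)"
    and mult_scale: "\<lbrakk>r \<in> carrier R; x \<in> carrier A; y \<in> carrier A\<rbrakk> \<Longrightarrow> x \<otimes>\<^bsub>A\<^esub> (r \<star> y) = r \<star> (x \<otimes>\<^bsub>A\<^esub> y)"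
begin

lemma linear_operator_mult_left: "x \<in> carrier A \<Longrightarrow> linear_operator (\<lambda>y. x \<otimes>\<^bsub>A\<^esub> y)"
  by (simp add: linear_operator_def alg.r_distr mult_scale del: add_coord)

lemma linear_operator_mult_right: "y \<in> carrier A \<Longrightarrow> linear_operator (\<lambda>x. x \<otimes>\<^bsub>A\<^esub> y)"
  by (simp add: linear_operator_def alg.l_distr scale_mult del: add_coord)

definition reg_trace :: "('b \<Rightarrow> 'a) \<Rightarrow> 'a" where
  "reg_trace x = trace (\<lambda>y. x \<otimes>\<^bsub>A\<^esub> y)"

definition trace_form :: "('b \<Rightarrow> 'a) \<Rightarrow> ('b \<Rightarrow> 'a) \<Rightarrow> 'a" where
  "trace_form x y = reg_trace (x \<otimes>\<^bsub>A\<^esub> y)"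

lemma linear_functional_reg_trace: "linear_functional reg_trace"
proof -
  have "linear_functional (\<lambda>x. (x \<otimes>\<^bsub>A\<^esub> basis b) b)" if "b \<in> D" for b
    using that by (intro linear_functional_comp[OF linear_functional_coord] linear_operator_mult_right) auto
  with finite_D have "linear_functional (\<lambda>x. \<Oplus>b\<in>D. (x \<otimes>\<^bsub>A\<^esub> basis b) b)"
    by (rule linear_functional_sum)
  then show ?thesis by (simp add: reg_trace_def[abs_def] trace_def)
qed

lemma linear_functional_trace_form_left: "y \<in> carrier A \<Longrightarrow> linear_functional (\<lambda>x. trace_form x y)"
  unfolding trace_form_def
  by (intro linear_functional_comp[OF linear_functional_reg_trace] linear_operator_mult_right)

lemma linear_functional_trace_form_right: "x \<in> carrier A \<Longrightarrow> linear_functional (trace_form x)"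
  unfolding trace_form_def[abs_def]
  by (intro linear_functional_comp[OF linear_functional_reg_trace] linear_operator_mult_left)

lemma trace_form_closed [simp, intro]:
  "x \<in> carrier A \<Longrightarrow> y \<in> carrier A \<Longrightarrow> trace_form x y \<in> carrier R"
  using linear_functional_trace_form_right linear_functional_closed by blast

lemma trace_form_assoc:
  "\<lbrakk>x \<in> carrier A; y \<in> carrier A; z \<in> carrier A\<rbrakk> \<Longrightarrow> trace_form (x \<otimes>\<^bsub>A\<^esub> y) z = trace_form x (y \<otimes>\<^bsub>A\<^esub> z)"
  by (simp add: trace_form_def alg.m_assoc)

lemma trace_form_commute:
  assumes x: "x \<in> carrier A" and y: "y \<in> carrier A"
  shows "trace_form x y = trace_form y x"
proof -
  have "trace_form x y = trace (\<lambda>z. x \<otimes>\<^bsub>A\<^esub> (y \<otimes>\<^bsub>A\<^esub> z))" if "x \<in> carrier A" "y \<in> carrier A" for x y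
    unfolding trace_form_def reg_trace_def
  proof (rule trace_cong)
    show "linear_operator (\<lambda>z. x \<otimes>\<^bsub>A\<^esub> (y \<otimes>\<^bsub>A\<^esub> z))"
      by (rule linear_operator_comp[OF linear_operator_mult_left linear_operator_mult_left]) (fact that)+
  qed (use that in \<open>simp add: alg.m_assoc\<close>)
  then show ?thesis
    using x y trace_comp_commute[OF linear_operator_mult_left[OF x] linear_operator_mult_left[OF y]] by simp
qed

lemma trace_form_rotate:
  "\<lbrakk>x \<in> carrier A; y \<in> carrier A; z \<in> carrier A\<rbrakk> \<Longrightarrow> trace_form (x \<otimes>\<^bsub>A\<^esub> y) z = trace_form y (z \<otimes>\<^bsub>A\<^esub> x)"
  by (simp add: trace_form_assoc trace_form_commute[of x])

definition dual_basis :: "('b \<Rightarrow> 'b \<Rightarrow> 'a) \<Rightarrow> bool" where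
  "dual_basis h \<longleftrightarrow> h \<in> D \<rightarrow> carrier A
    \<and> (\<forall>c\<in>D. \<forall>b\<in>D. trace_form (h c) (basis b) = (if c = b then \<one> else \<zero>))"

context
  fixes h :: "'b \<Rightarrow> 'b \<Rightarrow> 'a"
  assumes h: "dual_basis h"
begin

lemma dual_basis_closed: "c \<in> D \<Longrightarrow> h c \<in> carrier A"
  using h unfolding dual_basis_def by blast

lemma trace_form_dual_basis:
  assumes x: "x \<in> carrier A" and c: "c \<in> D"
  shows "trace_form (h c) x = x c"
proof -
  have "trace_form (h c) x = (\<Oplus>b\<in>D. x b \<otimes> trace_form (h c) (basis b))"
    using x linear_functional_trace_form_right[OF dual_basis_closed[OF c]]
    by (rule linear_functional_expansion[rotated])
  also have "\<dots> = (\<Oplus>b\<in>D. if c = b then x b else \<zero>)"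
    using h x c by (intro finsum_cong') (auto simp: dual_basis_def)
  also have "\<dots> = x c" using c x finite_D by (intro finsum_singleton) auto
  finally show ?thesis .
qed

lemma eq_if_trace_form_basis_eq:
  assumes x: "x \<in> carrier A" and y: "y \<in> carrier A"
    and eq: "\<And>b. b \<in> D \<Longrightarrow> trace_form x (basis b) = trace_form y (basis b)"
  shows "x = y"
proof (rule vec_eqI[OF x y])
  fix c assume c: "c \<in> D"
  note h_carrier = dual_basis_closed[OF c]
  have expand: "z c = (\<Oplus>b\<in>D. h c b \<otimes> trace_form z (basis b))" if "z \<in> carrier A" for z
    using trace_form_dual_basis[OF that c] trace_form_commute[OF h_carrier that]
      linear_functional_expansion[OF linear_functional_trace_form_right[OF that] h_carrier] by simp
  show "x c = y c"
    unfolding expand[OF x] expand[OF y] using eq y h_carrier by (intro finsum_cong') auto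
qed

lemma dual_basis_expansion:
  assumes x: "x \<in> carrier A"
  shows "x = (\<Oplus>\<^bsub>A\<^esub>c\<in>D. trace_form x (basis c) \<star> h c)"
proof (rule eq_if_trace_form_basis_eq[OF x])
  have terms: "(\<lambda>c. trace_form x (basis c) \<star> h c) \<in> D \<rightarrow> carrier A"
    using x dual_basis_closed by auto
  then show "(\<Oplus>\<^bsub>A\<^esub>c\<in>D. trace_form x (basis c) \<star> h c) \<in> carrier A" by (rule vec.finsum_closed)
  fix b assume b: "b \<in> D"
  then have functional: "linear_functional (\<lambda>y. trace_form y (basis b))"
    by (intro linear_functional_trace_form_left) auto
  have "trace_form (\<Oplus>\<^bsub>A\<^esub>c\<in>D. trace_form x (basis c) \<star> h c) (basis b)
      = (\<Oplus>c\<in>D. trace_form (trace_form x (basis c) \<star> h c) (basis b))"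
    by (rule linear_functional_finsum[OF functional terms])
  also have "\<dots> = (\<Oplus>c\<in>D. if b = c then trace_form x (basis c) else \<zero>)"
    using x b functional h dual_basis_closed
    by (intro finsum_cong') (auto simp: linear_functional_def dual_basis_def)
  also have "\<dots> = trace_form x (basis b)" using b x finite_D by (intro finsum_singleton) auto
  finally show "trace_form x (basis b) = trace_form (\<Oplus>\<^bsub>A\<^esub>c\<in>D. trace_form x (basis c) \<star> h c) (basis b)" ..
qed

lemma linear_operator_dual_basis_expansion:
  assumes F: "linear_operator F" and x: "x \<in> carrier A"
  shows "F x = (\<Oplus>\<^bsub>A\<^esub>c\<in>D. trace_form x (basis c) \<star> F (h c))"
  by (subst dual_basis_expansion[OF x], rule linear_operator_finsum_scale[OF F])
    (use x dual_basis_closed in auto)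

text \<open>The Casimir element \<open>\<Sum> e\<^sub>c \<otimes> h\<^sub>c\<close> commutes with \<open>y\<close>; tensors \<open>a \<otimes> b\<close> are replaced by
  their images \<open>a F(b)\<close>.\<close>

lemma casimir_slide:
  assumes y: "y \<in> carrier A" and F: "linear_operator F"
  shows "(\<Oplus>\<^bsub>A\<^esub>c\<in>D. (y \<otimes>\<^bsub>A\<^esub> basis c) \<otimes>\<^bsub>A\<^esub> F (h c)) = (\<Oplus>\<^bsub>A\<^esub>b\<in>D. basis b \<otimes>\<^bsub>A\<^esub> F (h b \<otimes>\<^bsub>A\<^esub> y))"
proof -
  define t where "t b c = trace_form (h b) (y \<otimes>\<^bsub>A\<^esub> basis c)" for b c
  have t: "t b c \<in> carrier R" if "b \<in> D" "c \<in> D" for b c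
    using that y dual_basis_closed by (auto simp: t_def)
  have Fh: "F (h c) \<in> carrier A" if "c \<in> D" for c
    using that F dual_basis_closed linear_operator_closed by blast
  have left: "(y \<otimes>\<^bsub>A\<^esub> basis c) \<otimes>\<^bsub>A\<^esub> F (h c) = (\<Oplus>\<^bsub>A\<^esub>b\<in>D. t b c \<star> (basis b \<otimes>\<^bsub>A\<^esub> F (h c)))"
    if c: "c \<in> D" for c
  proof -
    have "(y \<otimes>\<^bsub>A\<^esub> basis c) \<otimes>\<^bsub>A\<^esub> F (h c) = (\<Oplus>\<^bsub>A\<^esub>b\<in>D. (y \<otimes>\<^bsub>A\<^esub> basis c) b \<star> (basis b \<otimes>\<^bsub>A\<^esub> F (h c)))"
      using y c by (intro linear_operator_expansion[OF linear_operator_mult_right[OF Fh[OF c]]]) auto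
    also have "\<dots> = (\<Oplus>\<^bsub>A\<^esub>b\<in>D. t b c \<star> (basis b \<otimes>\<^bsub>A\<^esub> F (h c)))"
      using y c t Fh by (intro vec.finsum_cong') (auto simp: t_def trace_form_dual_basis)
    finally show ?thesis .
  qed
  have right: "basis b \<otimes>\<^bsub>A\<^esub> F (h b \<otimes>\<^bsub>A\<^esub> y) = (\<Oplus>\<^bsub>A\<^esub>c\<in>D. t b c \<star> (basis b \<otimes>\<^bsub>A\<^esub> F (h c)))"
    if b: "b \<in> D" for b
  proof -
    have "basis b \<otimes>\<^bsub>A\<^esub> F (h b \<otimes>\<^bsub>A\<^esub> y)
        = (\<Oplus>\<^bsub>A\<^esub>c\<in>D. trace_form (h b \<otimes>\<^bsub>A\<^esub> y) (basis c) \<star> (basis b \<otimes>\<^bsub>A\<^esub> F (h c)))"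
      using linear_operator_dual_basis_expansion[OF linear_operator_comp[OF linear_operator_mult_left F]]
        y b dual_basis_closed by simp
    also have "\<dots> = (\<Oplus>\<^bsub>A\<^esub>c\<in>D. t b c \<star> (basis b \<otimes>\<^bsub>A\<^esub> F (h c)))"
      using y b t Fh dual_basis_closed by (intro vec.finsum_cong') (auto simp: t_def trace_form_assoc)
    finally show ?thesis .
  qed
  show ?thesis
    using left right t Fh finite_D alg.finsum_finsum_swap[of D D "\<lambda>c b. t b c \<star> (basis b \<otimes>\<^bsub>A\<^esub> F (h c))"]
    by (simp add: Pi_iff cong: vec.finsum_cong)
qed

lemma casimir_product_eq_one: "(\<Oplus>\<^bsub>A\<^esub>c\<in>D. basis c \<otimes>\<^bsub>A\<^esub> h c) = \<one>\<^bsub>A\<^esub>"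
proof (rule eq_if_trace_form_basis_eq)
  have terms: "(\<lambda>c. basis c \<otimes>\<^bsub>A\<^esub> h c) \<in> D \<rightarrow> carrier A" using dual_basis_closed by auto
  then show "(\<Oplus>\<^bsub>A\<^esub>c\<in>D. basis c \<otimes>\<^bsub>A\<^esub> h c) \<in> carrier A" by (rule vec.finsum_closed)
  fix b assume b: "b \<in> D"
  have "trace_form (\<Oplus>\<^bsub>A\<^esub>c\<in>D. basis c \<otimes>\<^bsub>A\<^esub> h c) (basis b) = (\<Oplus>c\<in>D. trace_form (basis c \<otimes>\<^bsub>A\<^esub> h c) (basis b))"
    using b by (intro linear_functional_finsum[OF linear_functional_trace_form_left terms]) auto
  also have "\<dots> = (\<Oplus>c\<in>D. (basis b \<otimes>\<^bsub>A\<^esub> basis c) c)"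
    using b dual_basis_closed by (intro finsum_cong') (auto simp: trace_form_rotate trace_form_dual_basis)
  also have "\<dots> = trace_form \<one>\<^bsub>A\<^esub> (basis b)" using b by (simp add: trace_form_def reg_trace_def trace_def)
  finally show "trace_form (\<Oplus>\<^bsub>A\<^esub>c\<in>D. basis c \<otimes>\<^bsub>A\<^esub> h c) (basis b) = trace_form \<one>\<^bsub>A\<^esub> (basis b)" .
qed simp

end

end

locale finite_dim_algebra = coordinate_algebra R D A + coordinate_space R D A
  for R :: "('a, 'm) ring_scheme" (structure) and D :: "'b set" and A :: "('b \<Rightarrow> 'a, 'n) ring_scheme"
begin

lemma left_ideal_subspace:
  assumes I: "left_ideal I A"
  shows "subspace I"
proof -
  have "r \<star> x \<in> I" if r: "r \<in> carrier R" and x: "x \<in> I" for r x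
  proof -
    have "(r \<star> \<one>\<^bsub>A\<^esub>) \<otimes>\<^bsub>A\<^esub> x \<in> I" using r x I by (simp add: left_ideal_def)
    moreover have "x \<in> carrier A" using x I by (auto simp: left_ideal_def)
    ultimately show ?thesis using r by (simp add: scale_mult)
  qed
  then show ?thesis using I by (simp add: subspace_def left_ideal_def)
qed

theorem dual_basis_imp_semisimple:
  assumes h: "dual_basis h"
  shows "semisimple A"
proof (rule alg.left_ideal_right_unit_imp_semisimple)
  fix I assume I: "left_ideal I A"
  obtain P where P: "linear_operator P" "P \<in> carrier A \<rightarrow> I" "\<And>x. x \<in> I \<Longrightarrow> P x = x"
    using exists_projection[OF left_ideal_subspace[OF I]] unfolding projection_onto_def by blast
  have mult_I: "x \<otimes>\<^bsub>A\<^esub> y \<in> I" if "x \<in> carrier A" "y \<in> I" for x y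
    using I that by (auto simp: left_ideal_def)
  note h_carrier = dual_basis_closed[OF h]
  define e where "e = (\<Oplus>\<^bsub>A\<^esub>c\<in>D. basis c \<otimes>\<^bsub>A\<^esub> P (h c))"
  have P_carrier: "P (h c) \<in> carrier A" if "c \<in> D" for c
    using that h_carrier P(1) linear_operator_closed by blast
  have "e \<in> I"
    unfolding e_def
  proof (rule subspace_finsum[OF left_ideal_subspace[OF I]], rule funcsetI)
    show "basis c \<otimes>\<^bsub>A\<^esub> P (h c) \<in> I" if "c \<in> D" for c using that h_carrier P(2) mult_I by blast
  qed
  moreover have "y \<otimes>\<^bsub>A\<^esub> e = y" if y: "y \<in> I" for y
  proof -
    have y_carrier: "y \<in> carrier A" using y I by (auto simp: left_ideal_def)
    have "y \<otimes>\<^bsub>A\<^esub> e = (\<Oplus>\<^bsub>A\<^esub>c\<in>D. (y \<otimes>\<^bsub>A\<^esub> basis c) \<otimes>\<^bsub>A\<^esub> P (h c))"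
      unfolding e_def using y_carrier P_carrier finite_D
      by (subst alg.finsum_rdistr) (auto intro!: vec.finsum_cong' simp: alg.m_assoc)
    also have "\<dots> = (\<Oplus>\<^bsub>A\<^esub>b\<in>D. basis b \<otimes>\<^bsub>A\<^esub> P (h b \<otimes>\<^bsub>A\<^esub> y))" by (rule casimir_slide[OF h y_carrier P(1)])
    also have "\<dots> = (\<Oplus>\<^bsub>A\<^esub>b\<in>D. (basis b \<otimes>\<^bsub>A\<^esub> h b) \<otimes>\<^bsub>A\<^esub> y)"
      using y_carrier y h_carrier mult_I P(3) by (intro vec.finsum_cong') (auto simp: alg.m_assoc)
    also have "\<dots> = (\<Oplus>\<^bsub>A\<^esub>b\<in>D. basis b \<otimes>\<^bsub>A\<^esub> h b) \<otimes>\<^bsub>A\<^esub> y"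
      using y_carrier h_carrier finite_D by (intro alg.finsum_ldistr[symmetric]) auto
    also have "\<dots> = y" using y_carrier by (simp add: casimir_product_eq_one[OF h])
    finally show ?thesis .
  qed
  ultimately show "\<exists>e\<in>I. \<forall>y\<in>I. y \<otimes>\<^bsub>A\<^esub> e = y" by blast
qed

definition trace_radical :: "('b \<Rightarrow> 'a) set" where
  "trace_radical = {x \<in> carrier A. \<forall>y\<in>carrier A. trace_form x y = \<zero>}"

lemma left_ideal_trace_radical: "left_ideal trace_radical A"
proof (rule alg.left_idealI)
  show "\<zero>\<^bsub>A\<^esub> \<in> trace_radical"
    using linear_functional_zero[OF linear_functional_trace_form_left] by (simp add: trace_radical_def)
  show "x \<oplus>\<^bsub>A\<^esub> y \<in> trace_radical" if "x \<in> trace_radical" "y \<in> trace_radical" for x y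
    using that linear_functional_trace_form_left
    by (simp add: trace_radical_def linear_functional_def del: add_coord)
  show "a \<otimes>\<^bsub>A\<^esub> x \<in> trace_radical" if "a \<in> carrier A" "x \<in> trace_radical" for a x
    using that by (simp add: trace_radical_def trace_form_rotate)
qed (auto simp: trace_radical_def)

theorem semisimple_imp_trace_radical_trivial:
  assumes semisimple: "semisimple A" and char: "char_exceeds R (card D)"
  shows "trace_radical = {\<zero>\<^bsub>A\<^esub>}"
proof -
  obtain e where e: "e \<in> trace_radical" "\<And>x. x \<in> trace_radical \<Longrightarrow> x \<otimes>\<^bsub>A\<^esub> e = x"
    using alg.semisimple_imp_left_ideal_right_unit[OF semisimple left_ideal_trace_radical] by blast
  have e_carrier: "e \<in> carrier A" using e(1) by (simp add: trace_radical_def)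
  obtain n where n: "n \<le> card D" "reg_trace e = int_embed (int n)"
    "n = 0 \<longrightarrow> (\<lambda>x. e \<otimes>\<^bsub>A\<^esub> x) ` carrier A = {\<zero>\<^bsub>A\<^esub>}"
    using trace_idempotent[OF linear_operator_mult_left[OF e_carrier]] e(2)[OF e(1)] e_carrier
    by (auto simp: reg_trace_def simp flip: alg.m_assoc)
  have "reg_trace e = trace_form e \<one>\<^bsub>A\<^esub>" using e_carrier by (simp add: trace_form_def)
  also have "\<dots> = \<zero>" using e(1) by (simp add: trace_radical_def)
  finally have "n = 0" using n(1,2) int_embed_eq_zero_iff[OF char, of "int n"] by simp
  then have "e \<otimes>\<^bsub>A\<^esub> \<one>\<^bsub>A\<^esub> = \<zero>\<^bsub>A\<^esub>" using n(3) by blast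
  then have "x = \<zero>\<^bsub>A\<^esub>" if "x \<in> trace_radical" for x
    using e(2)[OF that] e_carrier that by (simp add: trace_radical_def)
  moreover have "\<zero>\<^bsub>A\<^esub> \<in> trace_radical" using left_ideal_trace_radical by (simp add: left_ideal_def)
  ultimately show ?thesis by blast
qed

end

section \<open>Integral structure constants\<close>

lemma matrix_left_inverse_up_to_scalar:
  fixes M :: "'a :: idom mat"
  assumes M: "M \<in> carrier_mat n n" and kernel: "\<And>v. v \<in> carrier_vec n \<Longrightarrow> M *\<^sub>v v = 0\<^sub>v n \<Longrightarrow> v = 0\<^sub>v n"
  obtains L k where "L \<in> carrier_mat n n" "k \<noteq> 0" "L * M = k \<cdot>\<^sub>m 1\<^sub>m n"
proof
  show "det M \<noteq> 0" using det_0_iff_vec_prod_zero[OF M] kernel by blast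
  show "adj_mat M \<in> carrier_mat n n" "adj_mat M * M = det M \<cdot>\<^sub>m 1\<^sub>m n" using adj_mat(1,3)[OF M] by auto
qed

lemma family_left_inverse_up_to_scalar:
  fixes G :: "'b \<Rightarrow> 'b \<Rightarrow> 'a :: idom"
  assumes finite: "finite D"
    and kernel: "\<And>v. (\<And>a. a \<in> D \<Longrightarrow> (\<Sum>b\<in>D. G a b * v b) = 0) \<Longrightarrow> (\<And>b. b \<in> D \<Longrightarrow> v b = 0)"
  shows "\<exists>H k. k \<noteq> 0 \<and> (\<forall>a\<in>D. \<forall>b\<in>D. (\<Sum>c\<in>D. H a c * G c b) = (if a = b then k else 0))"
proof -
  define n where "n = card D"
  obtain e where e: "bij_betw e {0..<n} D"
    using ex_bij_betw_nat_finite[OF finite] n_def by blast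
  define ix where "ix = inv_into {0..<n} e"
  have ix: "ix a < n" "e (ix a) = a" if "a \<in> D" for a
    using that e bij_betwE[OF bij_betw_inv_into[OF e]] bij_betw_inv_into_right[OF e]
    by (auto simp: ix_def)
  have e_ix: "e i \<in> D" "ix (e i) = i" if "i < n" for i
    using that bij_betwE[OF e] bij_betw_inv_into_left[OF e] by (simp_all add: ix_def)
  have sum_e: "(\<Sum>c\<in>D. F c) = (\<Sum>i = 0..<n. F (e i))" for F :: "'b \<Rightarrow> 'a"
    by (rule sum.reindex_bij_betw[OF e, symmetric])
  define M where "M = mat n n (\<lambda>(i, j). G (e i) (e j))"
  have M: "M \<in> carrier_mat n n" by (simp add: M_def)
  have "v = 0\<^sub>v n" if v: "v \<in> carrier_vec n" "M *\<^sub>v v = 0\<^sub>v n" for v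
  proof -
    have "(\<Sum>b\<in>D. G a b * v $ ix b) = (M *\<^sub>v v) $ ix a" if "a \<in> D" for a
      unfolding sum_e using v(1) ix[OF that] M by (simp add: scalar_prod_def M_def e_ix)
    then have "v $ ix b = 0" if "b \<in> D" for b
      using kernel[of "\<lambda>b. v $ ix b"] that v(2) ix by simp
    then have "v $ i = 0" if "i < n" for i using e_ix[OF that] by metis
    then show ?thesis using v(1) by auto
  qed
  then obtain L k where L: "L \<in> carrier_mat n n" and k: "k \<noteq> 0" and LM: "L * M = k \<cdot>\<^sub>m 1\<^sub>m n"
    using matrix_left_inverse_up_to_scalar[OF M] by metis
  have "(\<Sum>c\<in>D. L $$ (ix a, ix c) * G c b) = (if a = b then k else 0)" if a: "a \<in> D" and b: "b \<in> D" for a b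
  proof -
    have "(\<Sum>c\<in>D. L $$ (ix a, ix c) * G c b) = (L * M) $$ (ix a, ix b)"
      unfolding sum_e using L ix[OF a] ix[OF b] M by (simp add: scalar_prod_def M_def e_ix)
    moreover have "ix a = ix b \<longleftrightarrow> a = b" using ix a b by metis
    ultimately show ?thesis unfolding LM using ix[OF a] ix[OF b] by simp
  qed
  then show ?thesis using k by (intro exI[of _ "\<lambda>a c. L $$ (ix a, ix c)"] exI[of _ k]) blast
qed

locale structure_constants =
  fixes D :: "'b set" and s :: "'b \<Rightarrow> 'b \<Rightarrow> 'b \<Rightarrow> int" and u :: 'b
  assumes finite_D: "finite D" and u_in: "u \<in> D"
    and s_assoc: "\<lbrakk>a \<in> D; b \<in> D; c \<in> D; z \<in> D\<rbrakk>
      \<Longrightarrow> (\<Sum>x\<in>D. s a b x * s x c z) = (\<Sum>x\<in>D. s b c x * s a x z)"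
    and s_unit_left: "\<lbrakk>a \<in> D; b \<in> D\<rbrakk> \<Longrightarrow> s u a b = of_bool (a = b)"
    and s_unit_right: "\<lbrakk>a \<in> D; b \<in> D\<rbrakk> \<Longrightarrow> s a u b = of_bool (a = b)"
begin

definition gram :: "'b \<Rightarrow> 'b \<Rightarrow> int" where
  "gram a b = (\<Sum>c\<in>D. s a b c * (\<Sum>x\<in>D. s c x x))"

definition gram_nonsingular :: bool where
  "gram_nonsingular \<longleftrightarrow> (\<forall>v. (\<forall>a\<in>D. (\<Sum>b\<in>D. gram a b * v b) = 0) \<longrightarrow> (\<forall>b\<in>D. v b = 0))"

end

locale scalar_extension = structure_constants D s u + coordinate_space R D A
  for D :: "'b set" and s :: "'b \<Rightarrow> 'b \<Rightarrow> 'b \<Rightarrow> int" and u :: 'b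
    and R :: "('a, 'm) ring_scheme" (structure) and A :: "('b \<Rightarrow> 'a, 'n) ring_scheme" +
  assumes mult_coord: "\<lbrakk>x \<in> carrier A; y \<in> carrier A; c \<in> D\<rbrakk>
      \<Longrightarrow> (x \<otimes>\<^bsub>A\<^esub> y) c = finsum R (\<lambda>(a, b). (x a \<otimes> y b) \<otimes> int_embed (s a b c)) (D \<times> D)"
    and mult_outside: "\<lbrakk>x \<in> carrier A; y \<in> carrier A; c \<notin> D\<rbrakk> \<Longrightarrow> (x \<otimes>\<^bsub>A\<^esub> y) c = \<zero>"
    and one_A: "\<one>\<^bsub>A\<^esub> = basis u"
begin

lemma mult_closed: "x \<in> carrier A \<Longrightarrow> y \<in> carrier A \<Longrightarrow> x \<otimes>\<^bsub>A\<^esub> y \<in> carrier A"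
  by (rule vecI) (auto simp: mult_coord mult_outside intro!: finsum_closed)

lemma linear_operator_mult_left:
  assumes x: "x \<in> carrier A"
  shows "linear_operator (\<lambda>y. x \<otimes>\<^bsub>A\<^esub> y)"
proof (rule linear_operatorI)
  fix c assume c: "c \<in> D"
  have "linear_functional (\<lambda>y. \<Oplus>p\<in>D \<times> D. y (snd p) \<otimes> (x (fst p) \<otimes> int_embed (s (fst p) (snd p) c)))"
    using finite_D x
    by (intro linear_functional_sum linear_functional_mult_right linear_functional_coord) auto
  moreover have "(x \<otimes>\<^bsub>A\<^esub> y) c = (\<Oplus>p\<in>D \<times> D. y (snd p) \<otimes> (x (fst p) \<otimes> int_embed (s (fst p) (snd p) c)))"
    if "y \<in> carrier A" for y
    unfolding mult_coord[OF x that c] using x that by (intro finsum_cong') (auto simp: m_ac)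
  ultimately show "linear_functional (\<lambda>y. (x \<otimes>\<^bsub>A\<^esub> y) c)"
    using linear_functional_cong[of "\<lambda>y. (x \<otimes>\<^bsub>A\<^esub> y) c"] by simp
qed (rule mult_closed[OF x])

lemma linear_operator_mult_right:
  assumes y: "y \<in> carrier A"
  shows "linear_operator (\<lambda>x. x \<otimes>\<^bsub>A\<^esub> y)"
proof (rule linear_operatorI)
  fix c assume c: "c \<in> D"
  have "linear_functional (\<lambda>x. \<Oplus>p\<in>D \<times> D. x (fst p) \<otimes> (y (snd p) \<otimes> int_embed (s (fst p) (snd p) c)))"
    using finite_D y
    by (intro linear_functional_sum linear_functional_mult_right linear_functional_coord) auto
  moreover have "(x \<otimes>\<^bsub>A\<^esub> y) c = (\<Oplus>p\<in>D \<times> D. x (fst p) \<otimes> (y (snd p) \<otimes> int_embed (s (fst p) (snd p) c)))"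
    if "x \<in> carrier A" for x
    unfolding mult_coord[OF that y c] using y that by (intro finsum_cong') (auto simp: m_ac)
  ultimately show "linear_functional (\<lambda>x. (x \<otimes>\<^bsub>A\<^esub> y) c)"
    using linear_functional_cong[of "\<lambda>x. (x \<otimes>\<^bsub>A\<^esub> y) c"] by simp
qed (rule mult_closed[OF _ y])

lemma basis_mult_basis_coord:
  assumes a: "a \<in> D" and b: "b \<in> D" and c: "c \<in> D"
  shows "(basis a \<otimes>\<^bsub>A\<^esub> basis b) c = int_embed (s a b c)"
proof -
  have "(basis a \<otimes>\<^bsub>A\<^esub> basis b) c = (\<Oplus>p\<in>D \<times> D. if (a, b) = p then int_embed (s (fst p) (snd p) c) else \<zero>)"
    unfolding mult_coord[OF basis_closed[OF a] basis_closed[OF b] c]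
    by (intro finsum_cong') (auto simp: basis_def split: if_splits)
  also have "\<dots> = int_embed (s a b c)"
    using a b finite_D by (subst finsum_singleton) auto
  finally show ?thesis .
qed

lemma basis_mult_assoc:
  assumes a: "a \<in> D" and b: "b \<in> D" and c: "c \<in> D"
  shows "(basis a \<otimes>\<^bsub>A\<^esub> basis b) \<otimes>\<^bsub>A\<^esub> basis c = basis a \<otimes>\<^bsub>A\<^esub> (basis b \<otimes>\<^bsub>A\<^esub> basis c)"
proof (rule vec_eqI)
  fix z assume z: "z \<in> D"
  have "((basis a \<otimes>\<^bsub>A\<^esub> basis b) \<otimes>\<^bsub>A\<^esub> basis c) z = (\<Oplus>x\<in>D. (basis a \<otimes>\<^bsub>A\<^esub> basis b) x \<otimes> (basis x \<otimes>\<^bsub>A\<^esub> basis c) z)"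
    using a b c
    by (intro linear_functional_expansion linear_functional_comp[OF linear_functional_coord]
        linear_operator_mult_right mult_closed) auto
  also have "\<dots> = int_embed (\<Sum>x\<in>D. s a b x * s x c z)"
    unfolding int_embed_sum int_embed_mult using a b c z
    by (intro finsum_cong') (auto simp: basis_mult_basis_coord)
  also have "\<dots> = int_embed (\<Sum>x\<in>D. s b c x * s a x z)" using s_assoc[OF a b c z] by simp
  also have "\<dots> = (\<Oplus>x\<in>D. (basis b \<otimes>\<^bsub>A\<^esub> basis c) x \<otimes> (basis a \<otimes>\<^bsub>A\<^esub> basis x) z)"
    unfolding int_embed_sum int_embed_mult using a b c z
    by (intro finsum_cong') (auto simp: basis_mult_basis_coord mult_closed)
  also have "\<dots> = (basis a \<otimes>\<^bsub>A\<^esub> (basis b \<otimes>\<^bsub>A\<^esub> basis c)) z"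
    using a b c
    by (intro linear_functional_expansion[symmetric] linear_functional_comp[OF linear_functional_coord]
        linear_operator_mult_left mult_closed) auto
  finally show "((basis a \<otimes>\<^bsub>A\<^esub> basis b) \<otimes>\<^bsub>A\<^esub> basis c) z = (basis a \<otimes>\<^bsub>A\<^esub> (basis b \<otimes>\<^bsub>A\<^esub> basis c)) z" .
qed (use a b c in \<open>simp_all add: mult_closed\<close>)

lemma mult_assoc:
  assumes x: "x \<in> carrier A" and y: "y \<in> carrier A" and z: "z \<in> carrier A"
  shows "(x \<otimes>\<^bsub>A\<^esub> y) \<otimes>\<^bsub>A\<^esub> z = x \<otimes>\<^bsub>A\<^esub> (y \<otimes>\<^bsub>A\<^esub> z)"
proof -
  note left = linear_operator_mult_left and right = linear_operator_mult_right
  have basis_basis: "(basis a \<otimes>\<^bsub>A\<^esub> basis b) \<otimes>\<^bsub>A\<^esub> z = basis a \<otimes>\<^bsub>A\<^esub> (basis b \<otimes>\<^bsub>A\<^esub> z)" if "a \<in> D" "b \<in> D" for a b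
    by (rule linear_operator_eq_on_basis[OF left linear_operator_comp[OF left left] _ z])
      (use that basis_mult_assoc mult_closed in auto)
  have basis: "(basis a \<otimes>\<^bsub>A\<^esub> y) \<otimes>\<^bsub>A\<^esub> z = basis a \<otimes>\<^bsub>A\<^esub> (y \<otimes>\<^bsub>A\<^esub> z)" if "a \<in> D" for a
    by (rule linear_operator_eq_on_basis[OF linear_operator_comp[OF right left]
          linear_operator_comp[OF left right] _ y])
      (use that z basis_basis in auto)
  show ?thesis
    by (rule linear_operator_eq_on_basis[OF linear_operator_comp[OF right right] right _ x])
      (use y z basis mult_closed in auto)
qed

lemma one_mult:
  assumes x: "x \<in> carrier A"
  shows "\<one>\<^bsub>A\<^esub> \<otimes>\<^bsub>A\<^esub> x = x" "x \<otimes>\<^bsub>A\<^esub> \<one>\<^bsub>A\<^esub> = x"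
proof -
  have id: "linear_operator (\<lambda>x. x)" by (simp add: linear_operator_def)
  have u: "basis u \<in> carrier A" using u_in by (rule basis_closed)
  have "(basis u \<otimes>\<^bsub>A\<^esub> basis b) c = basis b c" "(basis b \<otimes>\<^bsub>A\<^esub> basis u) c = basis b c"
    if "b \<in> D" "c \<in> D" for b c
    unfolding basis_mult_basis_coord[OF u_in that] basis_mult_basis_coord[OF that(1) u_in that(2)]
    using that by (simp_all add: s_unit_left s_unit_right basis_def)
  then have "basis u \<otimes>\<^bsub>A\<^esub> basis b = basis b" "basis b \<otimes>\<^bsub>A\<^esub> basis u = basis b" if "b \<in> D" for b
    using that u by (simp_all add: vec_eqI mult_closed)
  then show "\<one>\<^bsub>A\<^esub> \<otimes>\<^bsub>A\<^esub> x = x" "x \<otimes>\<^bsub>A\<^esub> \<one>\<^bsub>A\<^esub> = x"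
    unfolding one_A
    using linear_operator_eq_on_basis[OF linear_operator_mult_left[OF u] id _ x]
      linear_operator_eq_on_basis[OF linear_operator_mult_right[OF u] id _ x] by auto
qed

lemma ring_A: "ring A"
proof (rule ringI)
  show "monoid A"
    by (rule monoidI) (simp_all add: mult_closed mult_assoc one_mult, simp add: one_A u_in)
  show "(x \<oplus>\<^bsub>A\<^esub> y) \<otimes>\<^bsub>A\<^esub> z = x \<otimes>\<^bsub>A\<^esub> z \<oplus>\<^bsub>A\<^esub> y \<otimes>\<^bsub>A\<^esub> z" "z \<otimes>\<^bsub>A\<^esub> (x \<oplus>\<^bsub>A\<^esub> y) = z \<otimes>\<^bsub>A\<^esub> x \<oplus>\<^bsub>A\<^esub> z \<otimes>\<^bsub>A\<^esub> y"
    if "x \<in> carrier A" "y \<in> carrier A" "z \<in> carrier A" for x y z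
    using that linear_operator_mult_right[of z] linear_operator_mult_left[of z]
    by (simp_all add: linear_operator_def del: add_coord)
qed (rule abelian_group_V)

lemma finite_dim_algebra_A: "finite_dim_algebra R D A"
proof (intro finite_dim_algebra.intro coordinate_algebra.intro coordinate_algebra_axioms.intro)
  show "(r \<star> x) \<otimes>\<^bsub>A\<^esub> y = r \<star> (x \<otimes>\<^bsub>A\<^esub> y)" "x \<otimes>\<^bsub>A\<^esub> (r \<star> y) = r \<star> (x \<otimes>\<^bsub>A\<^esub> y)"
    if "r \<in> carrier R" "x \<in> carrier A" "y \<in> carrier A" for r x y
    using that linear_operator_mult_right[of y] linear_operator_mult_left[of x]
    by (simp_all add: linear_operator_def)
qed (rule ring_A coordinate_module_axioms coordinate_space_axioms)+

end

sublocale scalar_extension \<subseteq> finite_dim_algebra R D A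
  by (rule finite_dim_algebra_A)

context scalar_extension
begin

lemma reg_trace_basis:
  assumes "a \<in> D"
  shows "reg_trace (basis a) = int_embed (\<Sum>x\<in>D. s a x x)"
  unfolding reg_trace_def trace_def int_embed_sum
  using assms by (intro finsum_cong') (auto simp: basis_mult_basis_coord)

lemma trace_form_basis:
  assumes a: "a \<in> D" and b: "b \<in> D"
  shows "trace_form (basis a) (basis b) = int_embed (gram a b)"
proof -
  have "trace_form (basis a) (basis b) = (\<Oplus>c\<in>D. (basis a \<otimes>\<^bsub>A\<^esub> basis b) c \<otimes> reg_trace (basis c))"
    unfolding trace_form_def using a b
    by (intro linear_functional_expansion[OF linear_functional_reg_trace]) auto
  also have "\<dots> = int_embed (gram a b)"
    unfolding gram_def int_embed_sum int_embed_mult using a b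
    by (intro finsum_cong') (auto simp: basis_mult_basis_coord reg_trace_basis int_embed_sum)
  finally show ?thesis .
qed

lemma semisimple_if_gram_left_inverse:
  assumes N: "int_embed N \<noteq> \<zero>"
    and H: "\<forall>a\<in>D. \<forall>b\<in>D. (\<Sum>c\<in>D. H a c * gram c b) = (if a = b then N else 0)"
  shows "semisimple A"
proof (rule dual_basis_imp_semisimple)
  have unit: "int_embed N \<in> Units R" using N by (simp add: field_Units)
  define h where "h a = (\<lambda>c. if c \<in> D then inv (int_embed N) \<otimes> int_embed (H a c) else \<zero>)" for a
  have h: "h a \<in> carrier A" for a
    by (rule vecI) (use unit in \<open>auto simp: h_def\<close>)
  have "trace_form (h a) (basis b) = (if a = b then \<one> else \<zero>)" if a: "a \<in> D" and b: "b \<in> D" for a b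
  proof -
    have "trace_form (h a) (basis b) = (\<Oplus>c\<in>D. h a c \<otimes> trace_form (basis c) (basis b))"
      using b h by (intro linear_functional_expansion[OF linear_functional_trace_form_left]) auto
    also have "\<dots> = (\<Oplus>c\<in>D. inv (int_embed N) \<otimes> int_embed (H a c * gram c b))"
      using b unit by (intro finsum_cong') (auto simp: h_def trace_form_basis int_embed_mult m_assoc)
    also have "\<dots> = inv (int_embed N) \<otimes> int_embed (\<Sum>c\<in>D. H a c * gram c b)"
      unfolding int_embed_sum using unit finite_D by (intro finsum_rdistr[symmetric]) auto
    finally show ?thesis using a b H unit by simp
  qed
  then show "dual_basis h" using h by (simp add: dual_basis_def)
qed

lemma not_semisimple_if_gram_kernel:
  assumes char: "char_exceeds R (card D)"
    and kernel: "\<forall>a\<in>D. (\<Sum>b\<in>D. gram a b * v b) = 0" and b: "b \<in> D" "int_embed (v b) \<noteq> \<zero>"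
  shows "\<not> semisimple A"
proof
  assume "semisimple A"
  then have radical: "trace_radical = {\<zero>\<^bsub>A\<^esub>}" using char by (rule semisimple_imp_trace_radical_trivial)
  define x where "x = (\<lambda>c. if c \<in> D then int_embed (v c) else \<zero>)"
  have x: "x \<in> carrier A" by (rule vecI) (auto simp: x_def)
  have basis: "trace_form x (basis a) = \<zero>" if a: "a \<in> D" for a
  proof -
    have "trace_form x (basis a) = (\<Oplus>c\<in>D. x c \<otimes> trace_form (basis a) (basis c))"
      unfolding trace_form_commute[OF x basis_closed[OF a]]
      using x a by (intro linear_functional_expansion[OF linear_functional_trace_form_right]) auto
    also have "\<dots> = int_embed (\<Sum>c\<in>D. gram a c * v c)"
      unfolding int_embed_sum using a
      by (intro finsum_cong') (auto simp: x_def trace_form_basis int_embed_mult m_comm)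
    finally show ?thesis using kernel a by simp
  qed
  have "trace_form x y = \<zero>" if y: "y \<in> carrier A" for y
  proof -
    have "trace_form x y = (\<Oplus>c\<in>D. y c \<otimes> trace_form x (basis c))"
      using x y by (rule linear_functional_expansion[OF linear_functional_trace_form_right])
    also have "\<dots> = \<zero>" using basis y by (simp add: add.finprod_one_eqI)
    finally show ?thesis .
  qed
  then have "x = \<zero>\<^bsub>A\<^esub>" using radical x by (auto simp: trace_radical_def)
  then show False using b by (simp add: x_def fun_eq_iff) (metis)
qed

end

context structure_constants
begin

theorem semisimple_iff_gram_nonsingular:
  "\<exists>N. \<forall>(R :: ('a, 'm) ring_scheme) (A :: ('b \<Rightarrow> 'a, 'n) ring_scheme).
    scalar_extension D s u R A \<longrightarrow> char_exceeds R N \<longrightarrow> (semisimple A \<longleftrightarrow> gram_nonsingular)"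
proof (cases gram_nonsingular)
  case True
  then obtain H N where "N \<noteq> 0" and H: "\<forall>a\<in>D. \<forall>b\<in>D. (\<Sum>c\<in>D. H a c * gram c b) = (if a = b then N else 0)"
    using family_left_inverse_up_to_scalar[OF finite_D, of gram] unfolding gram_nonsingular_def by blast
  show ?thesis
  proof (intro exI allI impI)
    fix R :: "('a, 'm) ring_scheme" and A :: "('b \<Rightarrow> 'a, 'n) ring_scheme"
    assume "scalar_extension D s u R A" and char: "char_exceeds R (nat \<bar>N\<bar>)"
    then interpret scalar_extension D s u R A by blast
    have "int_embed N \<noteq> \<zero>\<^bsub>R\<^esub>" using int_embed_eq_zero_iff[OF char] \<open>N \<noteq> 0\<close> by simp
    then show "semisimple A \<longleftrightarrow> gram_nonsingular" using semisimple_if_gram_left_inverse H True by blast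
  qed
next
  case False
  then obtain v b where v: "\<forall>a\<in>D. (\<Sum>b\<in>D. gram a b * v b) = 0" "b \<in> D" "v b \<noteq> 0"
    unfolding gram_nonsingular_def by blast
  show ?thesis
  proof (intro exI allI impI)
    fix R :: "('a, 'm) ring_scheme" and A :: "('b \<Rightarrow> 'a, 'n) ring_scheme"
    assume "scalar_extension D s u R A" and char: "char_exceeds R (max (card D) (nat \<bar>v b\<bar>))"
    then interpret scalar_extension D s u R A by blast
    have "int_embed (v b) \<noteq> \<zero>\<^bsub>R\<^esub>" using int_embed_eq_zero_iff[OF char] v(3) by simp
    moreover have "char_exceeds R (card D)" using char by (auto simp: char_exceeds_def le_max_iff_disj)
    ultimately show "semisimple A \<longleftrightarrow> gram_nonsingular"
      using not_semisimple_if_gram_kernel v(1,2) False by blast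
  qed
qed

end

lemma infinite_primes_iff_if_eventually_const:
  assumes "\<And>p :: nat. Factorial_Ring.prime p \<Longrightarrow> N < p \<Longrightarrow> P p \<longleftrightarrow> Q"
  shows "infinite {p :: nat. Factorial_Ring.prime p \<and> P p} \<longleftrightarrow> Q"
proof (cases Q)
  case True
  then have "{p :: nat. Factorial_Ring.prime p} \<subseteq> {p. Factorial_Ring.prime p \<and> P p} \<union> {..N}"
    using assms by (auto simp: not_le[symmetric])
  then have "infinite {p :: nat. Factorial_Ring.prime p \<and> P p}"
    using primes_infinite by (meson finite_UnI finite_atMost finite_subset)
  with True show ?thesis by simp
next
  case False
  then have "{p. Factorial_Ring.prime p \<and> P p} \<subseteq> {..N}"
    using assms by (auto simp: not_less[symmetric])
  then have "finite {p. Factorial_Ring.prime p \<and> P p}" by (rule finite_subset) simp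
  with False show ?thesis by simp
qed

theorem (in structure_constants) semisimple_iff_infinitely_many_primes:
  fixes B :: "nat \<Rightarrow> ('b \<Rightarrow> int) ring"
  assumes K: "scalar_extension D s u K A" and char: "\<And>N. char_exceeds K N"
    and Fp: "\<And>p. Factorial_Ring.prime p \<Longrightarrow> scalar_extension D s u (residue_ring (int p)) (B p)"
  shows "semisimple A \<longleftrightarrow> infinite {p. Factorial_Ring.prime p \<and> semisimple (B p)}"
proof -
  have "semisimple A \<longleftrightarrow> gram_nonsingular"
    using semisimple_iff_gram_nonsingular K char by blast
  moreover obtain N where N: "\<And>(R :: int ring) (C :: ('b \<Rightarrow> int) ring).
      scalar_extension D s u R C \<Longrightarrow> char_exceeds R N \<Longrightarrow> semisimple C \<longleftrightarrow> gram_nonsingular"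
    using semisimple_iff_gram_nonsingular by blast
  have "infinite {p. Factorial_Ring.prime p \<and> semisimple (B p)} \<longleftrightarrow> gram_nonsingular"
    using N[OF Fp char_exceeds_residue_ring[OF prime_gt_1_nat]]
    by (rule infinite_primes_iff_if_eventually_const)
  ultimately show ?thesis by simp
qed

section \<open>Diagram algebras\<close>

locale diagram_monoid =
  fixes d :: nat and D :: "diagram set"
  assumes D_brauer: "D \<subseteq> brauer_diagrams d" and id_in: "id_diagram d \<in> D"
    and compose_in: "a \<in> D \<Longrightarrow> b \<in> D \<Longrightarrow> compose d a b \<in> D"
begin

lemma finite_D: "finite D"
  using D_brauer finite_brauer_diagrams by (rule finite_subset)

definition diagram_constants :: "int \<Rightarrow> diagram \<Rightarrow> diagram \<Rightarrow> diagram \<Rightarrow> int" where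
  "diagram_constants \<delta> a b c = (if compose d a b = c then \<delta> ^ loops d a b else 0)"

lemma sum_diagram_constants_mult:
  assumes "a \<in> D" "b \<in> D"
  shows "(\<Sum>x\<in>D. diagram_constants \<delta> a b x * F x) = \<delta> ^ loops d a b * F (compose d a b)"
proof -
  have "(\<Sum>x\<in>D. diagram_constants \<delta> a b x * F x)
      = (\<Sum>x\<in>D. if compose d a b = x then \<delta> ^ loops d a b * F x else 0)"
    by (rule sum.cong) (auto simp: diagram_constants_def)
  then show ?thesis using assms by (simp add: finite_D compose_in)
qed

lemma structure_constants_diagram_constants: "structure_constants D (diagram_constants \<delta>) (id_diagram d)"
proof
  fix a b c z assume abc: "a \<in> D" "b \<in> D" "c \<in> D" "z \<in> D"
  then have "a \<in> brauer_diagrams d" "b \<in> brauer_diagrams d" "c \<in> brauer_diagrams d"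
    using D_brauer by auto
  from compose_assoc_loops[OF this]
  show "(\<Sum>x\<in>D. diagram_constants \<delta> a b x * diagram_constants \<delta> x c z)
      = (\<Sum>x\<in>D. diagram_constants \<delta> b c x * diagram_constants \<delta> a x z)"
    unfolding sum_diagram_constants_mult[OF abc(1,2)] sum_diagram_constants_mult[OF abc(2,3)]
    by (simp add: diagram_constants_def flip: power_add)
next
  fix a b assume "a \<in> D" "b \<in> D"
  then have "a \<in> brauer_diagrams d" using D_brauer by auto
  then show "diagram_constants \<delta> (id_diagram d) a b = of_bool (a = b)"
    "diagram_constants \<delta> a (id_diagram d) b = of_bool (a = b)"
    using compose_id_diagram_left compose_id_diagram_right by (auto simp: diagram_constants_def)
qed (auto simp: finite_D id_in)

lemma coordinate_space_diagram_alg: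
  assumes "field R"
  shows "coordinate_space R D (diagram_alg R \<delta> d D)"
proof -
  interpret field R by fact
  show ?thesis by unfold_locales (auto simp: finite_D diagram_alg_def)
qed

lemma mult_diagram_alg_coord:
  assumes R: "field R" and x: "x \<in> carrier (diagram_alg R \<delta> d D)" and y: "y \<in> carrier (diagram_alg R \<delta> d D)"
    and c: "c \<in> D"
  shows "(x \<otimes>\<^bsub>diagram_alg R \<delta> d D\<^esub> y) c
    = finsum R (\<lambda>(a, b). (x a \<otimes>\<^bsub>R\<^esub> y b) \<otimes>\<^bsub>R\<^esub> ring.int_embed R (diagram_constants \<delta> a b c)) (D \<times> D)"
proof -
  interpret field R by fact
  have closed: "x a \<in> carrier R" "y a \<in> carrier R" if "a \<in> D" for a
    using that x y by (auto simp: diagram_alg_def)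
  have "(x \<otimes>\<^bsub>diagram_alg R \<delta> d D\<^esub> y) c
      = finsum R (\<lambda>(a, b). (x a \<otimes>\<^bsub>R\<^esub> y b) \<otimes>\<^bsub>R\<^esub> (int_embed \<delta> [^]\<^bsub>R\<^esub> loops d a b))
          {(a, b). a \<in> D \<and> b \<in> D \<and> compose d a b = c}"
    using c by (simp add: diagram_alg_def int_embed_def)
  also have "\<dots> = finsum R (\<lambda>(a, b). (x a \<otimes>\<^bsub>R\<^esub> y b) \<otimes>\<^bsub>R\<^esub> int_embed (diagram_constants \<delta> a b c)) (D \<times> D)"
    using closed finite_D
    by (intro add.finprod_mono_neutral_cong_left)
      (auto simp: diagram_constants_def int_embed_power split: if_split_asm)
  finally show ?thesis .
qed

lemma mult_diagram_alg_outside: "c \<notin> D \<Longrightarrow> (x \<otimes>\<^bsub>diagram_alg R \<delta> d D\<^esub> y) c = \<zero>\<^bsub>R\<^esub>"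
  by (simp add: diagram_alg_def)

lemma one_diagram_alg: "\<one>\<^bsub>diagram_alg R \<delta> d D\<^esub> = (\<lambda>c. if id_diagram d = c then \<one>\<^bsub>R\<^esub> else \<zero>\<^bsub>R\<^esub>)"
  by (auto simp: diagram_alg_def)

lemma scalar_extension_diagram_alg:
  assumes R: "field R"
  shows "scalar_extension D (diagram_constants \<delta>) (id_diagram d) R (diagram_alg R \<delta> d D)"
proof (intro scalar_extension.intro scalar_extension_axioms.intro)
  show space: "coordinate_space R D (diagram_alg R \<delta> d D)"
    using R by (rule coordinate_space_diagram_alg)
  show "\<one>\<^bsub>diagram_alg R \<delta> d D\<^esub> = coordinate_module.basis R (id_diagram d)"
    unfolding one_diagram_alg coordinate_module.basis_def[OF coordinate_space.axioms(1)[OF space]] ..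
qed (fact structure_constants_diagram_constants |
    rule mult_diagram_alg_coord[OF R] mult_diagram_alg_outside; assumption)+

theorem semisimple_diagram_alg_iff:
  assumes K: "field K" and char: "\<forall>n::nat. n > 0 \<longrightarrow> [n] \<cdot>\<^bsub>K\<^esub> \<one>\<^bsub>K\<^esub> \<noteq> \<zero>\<^bsub>K\<^esub>"
  shows "semisimple (diagram_alg K \<delta> d D) \<longleftrightarrow>
    infinite {p :: nat. Factorial_Ring.prime p \<and> semisimple (diagram_alg (residue_ring (int p)) \<delta> d D)}"
proof (rule structure_constants.semisimple_iff_infinitely_many_primes)
  show "structure_constants D (diagram_constants \<delta>) (id_diagram d)"
    by (rule structure_constants_diagram_constants)
  show "scalar_extension D (diagram_constants \<delta>) (id_diagram d) K (diagram_alg K \<delta> d D)"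
    using K by (rule scalar_extension_diagram_alg)
  show "char_exceeds K N" for N using char by (simp add: char_exceeds_def)
  fix p :: nat assume p: "Factorial_Ring.prime p"
  then interpret residues_prime p "residue_ring (int p)" by unfold_locales auto
  show "scalar_extension D (diagram_constants \<delta>) (id_diagram d) (residue_ring (int p))
      (diagram_alg (residue_ring (int p)) \<delta> d D)"
    using is_field by (rule scalar_extension_diagram_alg)
qed

end

lemma diagram_monoid_brauer_diagrams: "diagram_monoid d (brauer_diagrams d)"
  by (rule diagram_monoid.intro) (simp_all add: compose_brauer_diagrams id_diagram_in_brauer_diagrams)

lemma diagram_monoid_walled_brauer_diagrams: "diagram_monoid (r + s) (walled_brauer_diagrams r s)"
  by (rule diagram_monoid.intro)
    (simp_all add: compose_walled_brauer_diagrams id_diagram_in_walled_brauer_diagrams,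
      auto simp: walled_brauer_diagrams_def)

theorem theoremA3:
  fixes K :: "('k, 'm) ring_scheme" and \<delta> :: int
  assumes "field K"
    and "\<forall>n::nat. n > 0 \<longrightarrow> [n] \<cdot>\<^bsub>K\<^esub> \<one>\<^bsub>K\<^esub> \<noteq> \<zero>\<^bsub>K\<^esub>"
  shows "(\<forall>r s :: nat. r + s > 0 \<longrightarrow>
            (semisimple (walled_brauer_alg K \<delta> r s) \<longleftrightarrow>
             infinite {p :: nat. Factorial_Ring.prime p \<and>
                semisimple (walled_brauer_alg (residue_ring (int p)) \<delta> r s)}))
       \<and> (\<forall>d :: nat. d > 0 \<longrightarrow>
            (semisimple (brauer_alg K \<delta> d) \<longleftrightarrow>
             infinite {p :: nat. Factorial_Ring.prime p \<and>
                semisimple (brauer_alg (residue_ring (int p)) \<delta> d)}))"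
  unfolding walled_brauer_alg_def brauer_alg_def
  using diagram_monoid.semisimple_diagram_alg_iff[OF diagram_monoid_walled_brauer_diagrams assms]
    diagram_monoid.semisimple_diagram_alg_iff[OF diagram_monoid_brauer_diagrams assms]
  by simp

end
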